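(* (Adaptive soft-thresholding with conservative tuning) Suppose that for given $i\ge1$ satisfying $i\le k=k(n)$ for large enough $n$ we have $\xi_{i,n}\eta_{i,n}\to0$ and $n^{1/2}\eta_{i,n}\to e_i$ where $0\le e_i<\infty$. Set the scaling factor $\alpha_{i,n}=n^{1/2}/\xi_{i,n}$. Suppose that the true parameters $\theta^{(n)}=(\theta_{1,n},\dots,\theta_{k_n,n})\in\mathbb{R}^{k_n}$ (with $k_n=k(n)$) and $\sigma_n\in(0,\infty)$ satisfy $n^{1/2}\theta_{i,n}/(\sigma_n\xi_{i,n})\to\nu_i\in\bar{\mathbb{R}}$. Let $H_n$ denote the cdf of $\sigma_n^{-1}\alpha_{i,n}(\tilde\theta_{AS,i}-\theta_{i,n})$ under $P_{n,\theta^{(n)},\sigma_n}$. (a) Suppose $n-k$ is eventually constant equal to $m$, say. Then, in case $|\nu_i|<\infty$, $H_n$ converges weakly to the distribution with cdf $$\int_0^\infty\Phi\left(0.5(x-\nu_i)+\sqrt{(0.5(x+\nu_i))^2+s^2e_i^2}\right)\rho_m(s)\,ds\,\mathbf{1}(x+\nu_i\ge0)+\int_0^\infty\Phi\left(0.5(x-\nu_i)-\sqrt{(0.5(x+\nu_i))^2+s^2e_i^2}\right)\rho_m(s)\,ds\,\mathbf{1}(x+\nu_i<0),$$ the corresponding measure being given by $$\int_0^\infty\left\{\Phi(-\nu_i+se_i)-\Phi(-\nu_i-se_i)\right\}\rho_m(s)\,ds\;d\delta_{-\nu_i}(x)$$ $$+\,0.5\int_0^\infty\Big\{\phi\left(0.5(x-\nu_i)+\sqrt{(0.5(x+\nu_i))^2+s^2e_i^2}\right)(1+t(x,s))\mathbf{1}(x+\nu_i>0)$$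 $$\qquad+\,\phi\left(0.5(x-\nu_i)-\sqrt{(0.5(x+\nu_i))^2+s^2e_i^2}\right)(1-t(x,s))\mathbf{1}(x+\nu_i<0)\Big\}\rho_m(s)\,ds\,dx,$$ where $t(x,s)=(x+\nu_i)/\sqrt{(x+\nu_i)^2+4s^2e_i^2}$. In case $|\nu_i|=\infty$, $H_n$ converges weakly to $\Phi$, i.e., a standard normal distribution. (If $e_i=0$, the limit always reduces to a standard normal distribution.) (b) If $n-k\to\infty$, then, in case $|\nu_i|<\infty$, $H_n$ converges weakly to the distribution with cdf $$\Phi\left(0.5(x-\nu_i)+\sqrt{(0.5(x+\nu_i))^2+e_i^2}\right)\mathbf{1}(x+\nu_i\ge0)+\Phi\left(0.5(x-\nu_i)-\sqrt{(0.5(x+\nu_i))^2+e_i^2}\right)\mathbf{1}(x+\nu_i<0),$$ the corresponding measure being $$\left\{\Phi(-\nu_i+e_i)-\Phi(-\nu_i-e_i)\right\}d\delta_{-\nu_i}(x)+0.5\Big\{\phi\left(0.5(x-\nu_i)+\sqrt{(0.5(x+\nu_i))^2+e_i^2}\right)(1+t(x))\mathbf{1}(x+\nu_i>0)$$ $$\qquad+\,\phi\left(0.5(x-\nu_i)-\sqrt{(0.5(x+\nu_i))^2+e_i^2}\right)(1-t(x))\mathbf{1}(x+\nu_i<0)\Big\}dx,$$ where $t(x)=(x+\nu_i)/\sqrt{(x+\nu_i)^2+4e_i^2}$; in case $|\nu_i|=\infty$, $H_n$ converges weakly to $\Phi$. (In case $e_i=0$ the limit always reduces to a standard normal distribution.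)
   Context: For each sample size $n$ consider the linear regression model $Y=X\theta+u$, where $X$ is a nonstochastic $n\times k$ matrix of rank $k\ge1$ with $k<n$, $\theta\in\mathbb{R}^k$, $u\sim N(0,\sigma^2I_n)$, $0<\sigma<\infty$. The number $k=k(n)$, the entries of $X,Y,u$ and the underlying probability space may depend on $n$. $P_{n,\theta,\sigma}$ denotes probability under parameters $\theta,\sigma$. $X'$ is the transpose of $X$. $\xi_{i,n}$ is the nonnegative square root of the $i$-th diagonal element of $(X'X/n)^{-1}$. $\hat\theta_{LS}=(X'X)^{-1}X'Y$ with $i$-th component $\hat\theta_{LS,i}$, and $\hat\sigma^2=(n-k)^{-1}(Y-X\hat\theta_{LS})'(Y-X\hat\theta_{LS})$, $\hat\sigma\ge0$. The tuning parameters $\eta_{i,n}$ are positive real numbers. The adaptive soft-thresholding estimator is $\tilde\theta_{AS,i}=\hat\theta_{LS,i}(1-\hat\sigma^2\xi_{i,n}^2\eta_{i,n}^2/\hat\theta_{LS,i}^2)_+$ (i.e. $0$ if $|\hat\theta_{LS,i}|\le\hat\sigma\xi_{i,n}\eta_{i,n}$, and $\hat\theta_{LS,i}-\hat\sigma^2\xi_{i,n}^2\eta_{i,n}^2/\hat\theta_{LS,i}$ otherwise), $(\cdot)_+=\max(\cdot,0)$. Standing assumption for all asymptotics: $\sup_n\xi_{j,n}^2/n<\infty$ for every fixed $j\ge1$ satisfying $j\le k(n)$ for large enough $n$. $\Phi,\phi$ are the standard normal cdf and pdf; $\bar{\mathbb{R}}=\mathbb{R}\cup\{-\infty,\infty\}$;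 $\delta_z$ is pointmass at $z$. $\rho_m$ is the density of $m^{-1/2}$ times the square root of a chi-square random variable with $m$ degrees of freedom, with $\rho_m(s)=0$ for $s<0$. *)

theory Defs
  imports
    "HOL-Probability.Probability"
    "Jordan_Normal_Form.Gauss_Jordan_Elimination"
    "Jordan_Normal_Form.DL_Rank"
begin

unbundle no vec_syntax

(* Since the numbers of rows and columns vary with the sample size, vectors and matrices are the
   carrier-based ones of Jordan_Normal_Form; their indices, in particular that of the coefficient
   of interest, start at 0. *)

section \<open>The regression model\<close>

(* The N(0, sigma^2 I_n) distribution of the errors is rendered as n independent N(0, sigma^2)
   components; M, theta and sigma together play the role of P_{n,theta,sigma}. *)
locale gaussian_regression = prob_space M
  for M :: "'a measure" +
  fixes n k :: nat
    and X :: "real mat"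
    and \<theta> :: "real Matrix.vec"
    and \<sigma> :: real
    and u Y :: "'a \<Rightarrow> real Matrix.vec"
  assumes k_pos: "1 \<le> k" and k_less_n: "k < n"
    and X_carrier: "X \<in> carrier_mat n k"
    and X_rank: "vec_space.rank n X = k"
    and \<theta>_carrier: "\<theta> \<in> carrier_vec k"
    and \<sigma>_pos: "0 < \<sigma>"
    and u_carrier: "\<And>\<omega>. \<omega> \<in> space M \<Longrightarrow> u \<omega> \<in> carrier_vec n"
    and u_indep: "indep_vars (\<lambda>_. borel) (\<lambda>j \<omega>. vec_index (u \<omega>) j) {..<n}"
    and u_normal: "\<And>j. j < n \<Longrightarrow> distributed M lborel (\<lambda>\<omega>. vec_index (u \<omega>) j) (normal_density 0 \<sigma>)"
    and Y_eq: "\<And>\<omega>. \<omega> \<in> space M \<Longrightarrow> Y \<omega> = X *\<^sub>v \<theta> + u \<omega>"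

section \<open>Estimators\<close>

(* In all uses below the inverted matrix is invertible, X having full column rank. *)
definition inverse_mat :: "real mat \<Rightarrow> real mat" where
  "inverse_mat A = the (mat_inverse A)"

definition theta_LS :: "real mat \<Rightarrow> real Matrix.vec \<Rightarrow> real Matrix.vec" where
  "theta_LS X y = inverse_mat (transpose_mat X * X) *\<^sub>v (transpose_mat X *\<^sub>v y)"

definition sigma_hat :: "real mat \<Rightarrow> real Matrix.vec \<Rightarrow> real" where
  "sigma_hat X y =
     (let r = y - X *\<^sub>v theta_LS X y
      in sqrt (scalar_prod r r / (real (dim_row X) - real (dim_col X))))"

definition xi :: "real mat \<Rightarrow> nat \<Rightarrow> real" where
  "xi X i = sqrt (inverse_mat ((1 / real (dim_row X)) \<cdot>\<^sub>m (transpose_mat X * X)) $$ (i, i))"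

(* Where the least squares component vanishes, division by zero yields 0, so the value is 0. *)
definition theta_AS :: "real mat \<Rightarrow> nat \<Rightarrow> real \<Rightarrow> real Matrix.vec \<Rightarrow> real" where
  "theta_AS X i \<eta> y =
     (let b = vec_index (theta_LS X y) i
      in b * max 0 (1 - (sigma_hat X y)\<^sup>2 * (xi X i)\<^sup>2 * \<eta>\<^sup>2 / b\<^sup>2))"

section \<open>Limit distributions\<close>

abbreviation Phi :: "real \<Rightarrow> real" where
  "Phi \<equiv> cdf std_normal_distribution"

abbreviation phi :: "real \<Rightarrow> real" where
  "phi \<equiv> std_normal_density"

definition chi_square_distribution :: "nat \<Rightarrow> real measure" where
  "chi_square_distribution m =
     distr (\<Pi>\<^sub>M j\<in>{..<m}. std_normal_distribution) borel (\<lambda>z. \<Sum>j<m. (z j)\<^sup>2)"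

(* For m > 0 the law below is absolutely continuous. Its density is determined up to Lebesgue
   null sets only, but rho m occurs only as a factor of Lebesgue integrands. *)
definition rho :: "nat \<Rightarrow> real \<Rightarrow> real" where
  "rho m s =
     (if s < 0 then 0
      else enn2real (RN_deriv lborel
             (distr (chi_square_distribution m) borel (\<lambda>q. sqrt q / sqrt (real m))) s))"

(* In z_plus, z_minus and t_fun the argument c stands for the threshold: s * e when the degrees
   of freedom stay fixed, e when they diverge. *)
definition z_plus :: "real \<Rightarrow> real \<Rightarrow> real \<Rightarrow> real" where
  "z_plus v c x = 0.5 * (x - v) + sqrt ((0.5 * (x + v))\<^sup>2 + c\<^sup>2)"

definition z_minus :: "real \<Rightarrow> real \<Rightarrow> real \<Rightarrow> real" where
  "z_minus v c x = 0.5 * (x - v) - sqrt ((0.5 * (x + v))\<^sup>2 + c\<^sup>2)"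

definition t_fun :: "real \<Rightarrow> real \<Rightarrow> real \<Rightarrow> real" where
  "t_fun v c x = (x + v) / sqrt ((x + v)\<^sup>2 + 4 * c\<^sup>2)"

definition limit_cdf_fixed_df :: "nat \<Rightarrow> real \<Rightarrow> real \<Rightarrow> real \<Rightarrow> real" where
  "limit_cdf_fixed_df m e v x =
     (LBINT s:{0..}. Phi (z_plus v (s * e) x) * rho m s) * of_bool (x + v \<ge> 0)
   + (LBINT s:{0..}. Phi (z_minus v (s * e) x) * rho m s) * of_bool (x + v < 0)"

definition limit_atom_fixed_df :: "nat \<Rightarrow> real \<Rightarrow> real \<Rightarrow> real" where
  "limit_atom_fixed_df m e v =
     (LBINT s:{0..}. (Phi (- v + s * e) - Phi (- v - s * e)) * rho m s)"

definition limit_dens_fixed_df :: "nat \<Rightarrow> real \<Rightarrow> real \<Rightarrow> real \<Rightarrow> real" where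
  "limit_dens_fixed_df m e v x =
     0.5 * (LBINT s:{0..}.
        (phi (z_plus v (s * e) x) * (1 + t_fun v (s * e) x) * of_bool (x + v > 0)
       + phi (z_minus v (s * e) x) * (1 - t_fun v (s * e) x) * of_bool (x + v < 0)) * rho m s)"

definition limit_cdf_infinite_df :: "real \<Rightarrow> real \<Rightarrow> real \<Rightarrow> real" where
  "limit_cdf_infinite_df e v x =
     Phi (z_plus v e x) * of_bool (x + v \<ge> 0) + Phi (z_minus v e x) * of_bool (x + v < 0)"

definition limit_atom_infinite_df :: "real \<Rightarrow> real \<Rightarrow> real" where
  "limit_atom_infinite_df e v = Phi (- v + e) - Phi (- v - e)"

definition limit_dens_infinite_df :: "real \<Rightarrow> real \<Rightarrow> real \<Rightarrow> real" where
  "limit_dens_infinite_df e v x =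
     0.5 * (phi (z_plus v e x) * (1 + t_fun v e x) * of_bool (x + v > 0)
          + phi (z_minus v e x) * (1 - t_fun v e x) * of_bool (x + v < 0))"

text \<open>The measure \<open>c d\<delta>\<^sub>z(x) + f(x) dx\<close>:\<close>

definition is_atom_plus_density :: "real measure \<Rightarrow> real \<Rightarrow> real \<Rightarrow> (real \<Rightarrow> real) \<Rightarrow> bool" where
  "is_atom_plus_density \<mu> c z f \<longleftrightarrow>
     sets \<mu> = sets borel \<and> 0 \<le> c \<and> (\<forall>x. 0 \<le> f x) \<and> f \<in> borel_measurable borel \<and>
     (\<forall>A\<in>sets borel. emeasure \<mu> A =
        ennreal c * emeasure (return borel z) A + (\<integral>\<^sup>+x\<in>A. ennreal (f x) \<partial>lborel))"

end

theory Submission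
  imports Defs
begin

text \<open>
The limits come from an exact description of the estimation error at every sample size. The error of
the \<open>i\<close>-th least squares component is a linear form \<open>c \<bullet> u\<close>, and \<open>\<xi> = sqrt n * norm c\<close>. Divide all
quantities by \<open>\<sigma> * norm c\<close>: the least squares error becomes a standard normal \<open>Z\<close>, the parameter
becomes \<open>\<nu>\<^sub>n = sqrt n * \<theta>\<^sub>i / (\<sigma> * \<xi>)\<close>, and since adaptive soft-thresholding commutes with scaling, the
scaled error of the estimator is
\<open>soft_threshold (D * sqrt n * \<eta>) (Z + \<nu>\<^sub>n) - \<nu>\<^sub>n\<close> with \<open>D\<close> the ratio of estimated and true error
scale. Here \<open>Z\<close> and \<open>D\<close> are independent and \<open>D\<close> is distributed as the root of a chi-square variable
divided by its \<open>n - k\<close> degrees of freedom (\<open>distr_scaled_estimation_error\<close>).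

The map \<open>soft_threshold\<close> is continuous in threshold and argument jointly, and it moves a large
argument only little. If the laws of \<open>D\<close> converge weakly, they may be realised by Skorohod's theorem
as pointwise convergent random variables, and then the scaled errors converge pointwise: to
\<open>soft_threshold (D * e) (Z + \<nu>) - \<nu>\<close> when \<open>\<nu>\<close> is finite, and to \<open>Z\<close> when it is infinite
(\<open>weak_conv_mixed_limit_law\<close>). With fixed degrees of freedom the law of \<open>D\<close> is constant; with
diverging ones it shrinks to the point \<open>1\<close> by Chebyshev's inequality (\<open>weak_conv_chi_law\<close>).

The closed forms of the limit are obtained for a deterministic threshold first. The map is
nondecreasing in its argument, and inverting it means solving a quadratic equation whose
two roots, shifted by \<open>- \<nu>\<close>, are \<open>z_plus\<close> and \<open>z_minus\<close>; this gives the distribution function. An atom can sit only at \<open>- \<nu>\<close>, the value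
taken on the whole interval that is thresholded to zero, and off this point the fundamental theorem
of calculus gives the density. The limit for fixed degrees of freedom is the mixture over the law of
\<open>D\<close>, and Tonelli's theorem carries atom and density over to it.

The independence of \<open>Z\<close> and \<open>D\<close>, and the law of \<open>D\<close>, hold because the coordinates of a standard Gaussian vector
with respect to any orthonormal system are again independent standard normal
(\<open>std_normal_product_orthonormal\<close>). This follows from a uniqueness theorem for joint characteristic
functions, because linear forms in the coordinates have the right normal law. The orthonormal system
consists of \<open>c / norm c\<close> and a basis of the orthogonal complement of the columns of the design
matrix, which Householder reflections provide (\<open>orthonormal_triangular_basis\<close>).
\<close>

section \<open>The adaptive soft-thresholding map\<close>

definition soft_threshold :: "real \<Rightarrow> real \<Rightarrow> real" where
  "soft_threshold c y = y * max 0 (1 - c\<^sup>2 / y\<^sup>2)"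

lemma measurable_soft_threshold [measurable]:
  assumes [measurable]: "f \<in> borel_measurable M" "g \<in> borel_measurable M"
  shows "(\<lambda>x. soft_threshold (f x) (g x)) \<in> borel_measurable M"
  unfolding soft_threshold_def by measurable

lemma soft_threshold_0_left [simp]: "soft_threshold 0 y = y"
  by (simp add: soft_threshold_def)

lemma soft_threshold_inside: "\<bar>y\<bar> \<le> c \<Longrightarrow> soft_threshold c y = 0"
proof (cases "y = 0")
  case False
  assume "\<bar>y\<bar> \<le> c"
  then have "y\<^sup>2 \<le> c\<^sup>2" by (metis abs_ge_zero power2_abs power_mono)
  with False have "1 - c\<^sup>2 / y\<^sup>2 \<le> 0" by simp
  then show ?thesis by (simp add: soft_threshold_def)
qed (simp add: soft_threshold_def)

lemma soft_threshold_outside: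
  assumes "0 \<le> c" "c < \<bar>y\<bar>" shows "soft_threshold c y = y - c\<^sup>2 / y"
proof -
  from assms have "c\<^sup>2 \<le> y\<^sup>2" by (metis less_imp_le power2_abs power_mono)
  with assms have "0 \<le> 1 - c\<^sup>2 / y\<^sup>2" by (auto simp: divide_le_eq)
  then have "soft_threshold c y = y * (1 - c\<^sup>2 / y\<^sup>2)" by (simp add: soft_threshold_def)
  also have "\<dots> = y - c\<^sup>2 / y" using assms by (simp add: field_simps power2_eq_square)
  finally show ?thesis .
qed

text \<open>For \<open>\<bar>y\<bar> > c\<close> the inequality \<open>y - c\<^sup>2 / y \<le> w\<close> becomes, after multiplication by \<open>y\<close>, the sign condition on
\<open>y\<^sup>2 - w * y - c\<^sup>2\<close>, whose roots are \<open>w / 2 \<plusminus> sqrt ((w / 2)\<^sup>2 + c\<^sup>2)\<close>. The generalised inverse of the map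
is the root with the sign of \<open>w\<close>: its absolute value is at least \<open>c\<close>, and between \<open>- c\<close> and \<open>c\<close> the map vanishes.\<close>

lemma soft_threshold_le_iff:
  fixes c y w :: real
  assumes c: "0 \<le> c"
  shows "soft_threshold c y \<le> w \<longleftrightarrow>
    y \<le> (if 0 \<le> w then w / 2 + sqrt ((w / 2)\<^sup>2 + c\<^sup>2) else w / 2 - sqrt ((w / 2)\<^sup>2 + c\<^sup>2))"
proof -
  define r where "r = sqrt ((w / 2)\<^sup>2 + c\<^sup>2)"
  have r2: "r\<^sup>2 = (w / 2)\<^sup>2 + c\<^sup>2" and r0: "0 \<le> r" by (auto simp: r_def)
  have rw: "\<bar>w / 2\<bar> \<le> r" unfolding r_def
    by (metis le_add_same_cancel1 power2_abs real_le_rsqrt zero_le_power2)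
  have rc: "c \<le> r" unfolding r_def by (simp add: real_le_rsqrt)
  have fac: "y\<^sup>2 - w * y - c\<^sup>2 = (y - (w / 2 + r)) * (y - (w / 2 - r))"
    using r2 by (simp add: field_simps power2_eq_square)
  consider "\<bar>y\<bar> \<le> c" | "c < y" | "y < - c" by linarith
  then have "soft_threshold c y \<le> w \<longleftrightarrow> y \<le> (if 0 \<le> w then w / 2 + r else w / 2 - r)"
  proof cases
    case 1
    then show ?thesis using rw rc r0 by (auto simp: soft_threshold_inside)
  next
    case 2
    then have y: "0 < y" using c by simp
    have "y - c\<^sup>2 / y = soft_threshold c y" using 2 c by (simp add: soft_threshold_outside)
    moreover have "y - c\<^sup>2 / y \<le> w \<longleftrightarrow> y\<^sup>2 - w * y - c\<^sup>2 \<le> 0"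
      using y by (simp add: field_simps power2_eq_square)
    moreover have "y - (w / 2 - r) > 0" using y rw by linarith
    ultimately have "soft_threshold c y \<le> w \<longleftrightarrow> y \<le> w / 2 + r"
      unfolding fac by (simp add: mult_le_0_iff)
    moreover have "\<not> y \<le> w / 2 - r" using y rw by linarith
    moreover have "\<not> y \<le> w / 2 + r" if "w < 0" "soft_threshold c y \<le> w"
    proof -
      have "c\<^sup>2 / y \<le> y" using 2 c y by (simp add: divide_le_eq power2_eq_square mult_mono)
      then have "0 \<le> soft_threshold c y" using \<open>y - c\<^sup>2 / y = _\<close> by simp
      with that show ?thesis by simp
    qed
    ultimately show ?thesis by auto
  next
    case 3
    then have y: "y < 0" using c by simp
    have st: "y - c\<^sup>2 / y = soft_threshold c y" using 3 c by (simp add: soft_threshold_outside)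
    have "y - c\<^sup>2 / y \<le> w \<longleftrightarrow> 0 \<le> y\<^sup>2 - w * y - c\<^sup>2"
      using y by (simp add: field_simps power2_eq_square)
    moreover have "y - (w / 2 + r) < 0" using y rw by linarith
    ultimately have eq: "soft_threshold c y \<le> w \<longleftrightarrow> y \<le> w / 2 - r"
      unfolding fac st by (simp add: zero_le_mult_iff)
    moreover have "soft_threshold c y \<le> w" if "0 \<le> w"
    proof -
      have "c * c \<le> (-y) * (-y)" using 3 c by (intro mult_mono) auto
      then have "y \<le> c\<^sup>2 / y" using y by (simp add: le_divide_eq power2_eq_square)
      then show ?thesis using st that by simp
    qed
    moreover have "y \<le> w / 2 + r" using y rw by linarith
    ultimately show ?thesis by auto
  qed
  then show ?thesis unfolding r_def .
qed

lemma abs_soft_threshold_le: "\<bar>soft_threshold c y\<bar> \<le> \<bar>y\<bar>"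
proof -
  have "\<bar>max 0 (1 - c\<^sup>2 / y\<^sup>2)\<bar> \<le> 1" by (auto simp: max_def)
  then show ?thesis unfolding soft_threshold_def abs_mult
    by (metis abs_ge_zero mult.right_neutral mult_left_mono)
qed

lemma soft_threshold_diff_le:
  assumes "y \<noteq> 0" shows "\<bar>soft_threshold c y - y\<bar> \<le> c\<^sup>2 / \<bar>y\<bar>"
proof -
  have "\<bar>max 0 (1 - c\<^sup>2 / y\<^sup>2) - 1\<bar> \<le> c\<^sup>2 / y\<^sup>2" by (auto simp: max_def)
  then have "\<bar>y\<bar> * \<bar>max 0 (1 - c\<^sup>2 / y\<^sup>2) - 1\<bar> \<le> \<bar>y\<bar> * (c\<^sup>2 / y\<^sup>2)"
    by (rule mult_left_mono) simp
  also have "\<bar>y\<bar> * (c\<^sup>2 / y\<^sup>2) = c\<^sup>2 / \<bar>y\<bar>"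
    using assms by (simp add: field_simps power2_eq_square abs_if)
  also have "\<bar>y\<bar> * \<bar>max 0 (1 - c\<^sup>2 / y\<^sup>2) - 1\<bar> = \<bar>soft_threshold c y - y\<bar>"
    unfolding soft_threshold_def abs_mult[symmetric] by (simp add: algebra_simps)
  finally show ?thesis .
qed

text \<open>At \<open>y = 0\<close> the quotient \<open>c\<^sup>2 / y\<^sup>2\<close> has no limit; there continuity follows from the contraction bound
instead.\<close>

lemma tendsto_soft_threshold:
  assumes f: "(f \<longlongrightarrow> c) F" and g: "(g \<longlongrightarrow> y) F"
  shows "((\<lambda>n. soft_threshold (f n) (g n)) \<longlongrightarrow> soft_threshold c y) F"
proof (cases "y = 0")
  case True
  have "((\<lambda>n. \<bar>g n\<bar>) \<longlongrightarrow> 0) F" using g True by (simp add: tendsto_rabs_zero)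
  then have "((\<lambda>n. soft_threshold (f n) (g n)) \<longlongrightarrow> 0) F"
    by (rule Lim_null_comparison[rotated]) (simp add: abs_soft_threshold_le)
  then show ?thesis using True by (simp add: soft_threshold_def)
next
  case False
  then show ?thesis unfolding soft_threshold_def
    by (intro tendsto_intros f g) auto
qed

text \<open>This is what makes the threshold negligible when the scaled parameter diverges.\<close>

lemma soft_threshold_at_infinity:
  assumes f: "(f \<longlongrightarrow> c) F" and g: "filterlim g at_infinity F"
  shows "((\<lambda>n. soft_threshold (f n) (g n) - g n) \<longlongrightarrow> 0) F"
proof (rule Lim_null_comparison)
  have "eventually (\<lambda>n. g n \<noteq> 0) F"
    using g by (rule filterlim_at_infinity_imp_eventually_ne)
  then show "eventually (\<lambda>n. norm (soft_threshold (f n) (g n) - g n) \<le> (f n)\<^sup>2 / \<bar>g n\<bar>) F"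
    by eventually_elim (auto intro: soft_threshold_diff_le)
  have "((\<lambda>n. (f n)\<^sup>2) \<longlongrightarrow> c\<^sup>2) F" by (intro tendsto_intros f)
  then have "((\<lambda>n. \<bar>(f n)\<^sup>2 / g n\<bar>) \<longlongrightarrow> \<bar>0\<bar>) F"
    by (intro tendsto_rabs tendsto_divide_0[OF _ g])
  then show "((\<lambda>n. (f n)\<^sup>2 / \<bar>g n\<bar>) \<longlongrightarrow> 0) F" by simp
qed

section \<open>The standard normal distribution function\<close>

interpretation std_normal: real_distribution std_normal_distribution
  by (rule real_dist_normal_dist)

lemma emeasure_std_normal_singleton [simp]: "emeasure std_normal_distribution {x} = 0"
  by (subst emeasure_density) (auto simp: nn_integral_indicator_singleton' emeasure_lborel_singleton nn_integral_0_iff_AE intro!: AE_I[of _ _ "{x}"])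

lemma measure_std_normal_Icc:
  assumes "a \<le> b" shows "measure std_normal_distribution {a..b} = Phi b - Phi a"
proof -
  have "measure std_normal_distribution {a..b} = measure std_normal_distribution {..b} - measure std_normal_distribution {..<a}"
    using assms by (subst std_normal.finite_measure_Diff[symmetric]) (auto intro!: arg_cong[where f="measure _"])
  also have "measure std_normal_distribution {..<a} = measure std_normal_distribution {..a} - measure std_normal_distribution {a}"
    by (subst std_normal.finite_measure_Diff[symmetric]) (auto intro!: arg_cong[where f="measure _"])
  finally show ?thesis by (simp add: cdf_def measure_def)
qed

lemma DERIV_Phi [derivative_intros]:
  assumes "(f has_real_derivative f') (at x within S)"
  shows "((\<lambda>x. Phi (f x)) has_real_derivative phi (f x) * f') (at x within S)"
proof -
  have "(Phi has_real_derivative phi y) (at y)" for y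
  proof -
    have cont: "continuous_on A phi" for A
      unfolding normal_density_def by (intro continuous_intros) auto
    have eq: "Phi x = Phi (y - 1) + integral {y - 1..x} phi" if "x \<in> {y - 1..y + 1}" for x
    proof -
      have int: "set_integrable lborel {y - 1..x} phi"
        by (rule borel_integrable_atLeastAtMost') (rule cont)
      have "ennreal (measure std_normal_distribution {y - 1..x}) = (\<integral>\<^sup>+ z. ennreal (phi z) * indicator {y - 1..x} z \<partial>lborel)"
        by (simp add: std_normal.emeasure_eq_measure[symmetric] emeasure_density)
      also have "\<dots> = (\<integral>\<^sup>+ z. ennreal (indicator {y - 1..x} z * phi z) \<partial>lborel)"
        by (intro nn_integral_cong) (auto split: split_indicator)
      also have "\<dots> = ennreal (LBINT z:{y - 1..x}. phi z)"
        using int unfolding set_lebesgue_integral_def set_integrable_def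
        by (subst nn_integral_eq_integral) auto
      finally have "measure std_normal_distribution {y - 1..x} = (LBINT z:{y - 1..x}. phi z)"
        by (subst (asm) ennreal_inj) (auto simp: set_lebesgue_integral_def intro!: integral_nonneg_AE)
      also have "\<dots> = integral {y - 1..x} phi"
        by (rule set_borel_integral_eq_integral(2)[OF int])
      finally show ?thesis using that by (simp add: measure_std_normal_Icc)
    qed
    have "((\<lambda>x. integral {y - 1..x} phi) has_real_derivative phi y) (at y within {y - 1..y + 1})"
      by (rule integral_has_real_derivative) (auto intro: cont)
    then have "((\<lambda>x. Phi (y - 1) + integral {y - 1..x} phi) has_real_derivative phi y) (at y within {y - 1..y + 1})"
      by (auto intro!: derivative_eq_intros)
    then have "(Phi has_real_derivative phi y) (at y within {y - 1..y + 1})"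
      by (rule has_field_derivative_transform_within[where d=1]) (auto simp: dist_real_def intro!: eq[symmetric])
    then show ?thesis by (subst (asm) at_within_interior) auto
  qed
  from DERIV_chain2[OF this assms] show ?thesis .
qed

lemma continuous_Phi: "isCont Phi x"
  by (auto simp: std_normal.isCont_cdf measure_def)

section \<open>The limit law for a fixed threshold\<close>

definition limit_law :: "real \<Rightarrow> real \<Rightarrow> real measure" where
  "limit_law v c = distr std_normal_distribution borel (\<lambda>z. soft_threshold c (z + v) - v)"

lemma real_distribution_limit_law: "real_distribution (limit_law v c)"
  unfolding limit_law_def by (rule std_normal.real_distribution_distr) simp

lemma limit_law_0: "limit_law v 0 = std_normal_distribution"
  unfolding limit_law_def by (simp add: distr_id2)

lemma z_plus_alt: "z_plus v c x = (x - v) / 2 + sqrt (((x + v) / 2)\<^sup>2 + c\<^sup>2)"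
  by (simp add: z_plus_def)

lemma z_minus_alt: "z_minus v c x = (x - v) / 2 - sqrt (((x + v) / 2)\<^sup>2 + c\<^sup>2)"
  by (simp add: z_minus_def)

lemma soft_threshold_shift_le_iff:
  assumes "0 \<le> c"
  shows "soft_threshold c (z + v) - v \<le> x \<longleftrightarrow> z \<le> (if 0 \<le> x + v then z_plus v c x else z_minus v c x)"
  using soft_threshold_le_iff[OF assms, of "z + v" "x + v"]
  by (auto simp: z_plus_def z_minus_def algebra_simps add_divide_distrib diff_divide_distrib split: if_splits)

lemma cdf_limit_law:
  assumes "0 \<le> c"
  shows "cdf (limit_law v c) x = limit_cdf_infinite_df c v x"
proof -
  have "cdf (limit_law v c) x = measure std_normal_distribution {z. soft_threshold c (z + v) - v \<le> x}"
    unfolding cdf_def limit_law_def by (subst measure_distr) (auto simp: vimage_def)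
  also have "{z. soft_threshold c (z + v) - v \<le> x} = {..(if 0 \<le> x + v then z_plus v c x else z_minus v c x)}"
    using soft_threshold_shift_le_iff[OF assms] by auto
  finally show ?thesis by (auto simp: limit_cdf_infinite_df_def cdf_def)
qed

lemma soft_threshold_eq_0_iff:
  assumes "0 \<le> c" shows "soft_threshold c y = 0 \<longleftrightarrow> \<bar>y\<bar> \<le> c"
proof
  assume *: "soft_threshold c y = 0"
  show "\<bar>y\<bar> \<le> c"
  proof (rule ccontr)
    assume "\<not> \<bar>y\<bar> \<le> c"
    then have "c < \<bar>y\<bar>" by simp
    moreover from this assms have "y \<noteq> 0" by auto
    ultimately have "y\<^sup>2 = c\<^sup>2" using * assms by (simp add: soft_threshold_outside field_simps power2_eq_square)
    then show False using \<open>c < \<bar>y\<bar>\<close> assms by (auto simp: power2_eq_iff)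
  qed
qed (rule soft_threshold_inside)

text \<open>All arguments of absolute value at most \<open>c\<close> are mapped to zero, so their whole probability sits in
one point.\<close>

lemma measure_limit_law_atom:
  assumes "0 \<le> c"
  shows "measure (limit_law v c) {- v} = limit_atom_infinite_df c v"
proof -
  have "measure (limit_law v c) {- v} = measure std_normal_distribution {z. soft_threshold c (z + v) = 0}"
    unfolding limit_law_def by (subst measure_distr) (auto simp: vimage_def)
  also have "{z. soft_threshold c (z + v) = 0} = {- v - c..- v + c}"
    using assms by (auto simp: soft_threshold_eq_0_iff abs_le_iff)
  finally show ?thesis using assms by (simp add: measure_std_normal_Icc limit_atom_infinite_df_def)
qed

lemma abs_t_fun_le: "\<bar>t_fun v c x\<bar> \<le> 1"
proof -
  have "\<bar>x + v\<bar> \<le> sqrt ((x + v)\<^sup>2 + 4 * c\<^sup>2)"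
    by (rule real_le_rsqrt) simp
  then have "\<bar>x + v\<bar> / \<bar>sqrt ((x + v)\<^sup>2 + 4 * c\<^sup>2)\<bar> \<le> 1"
    by (intro divide_le_eq_1[THEN iffD2]) linarith
  then show ?thesis unfolding t_fun_def abs_divide .
qed

lemma limit_dens_infinite_df_nonneg: "0 \<le> limit_dens_infinite_df c v x"
  using abs_t_fun_le[of v c x] by (auto simp: limit_dens_infinite_df_def)

lemma std_normal_density_le_1: "phi x \<le> 1"
proof -
  have "exp (- x\<^sup>2 / 2) \<le> 1" by simp
  moreover have "1 \<le> sqrt (2 * pi)" using pi_gt3 by (simp add: real_le_rsqrt)
  ultimately have "1 / sqrt (2 * pi) * exp (- x\<^sup>2 / 2) \<le> 1 * 1"
    by (intro mult_mono) auto
  then show ?thesis unfolding std_normal_density_def by simp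
qed

text \<open>Only finiteness of the bound matters: it makes the density integrable against the law of the scale.\<close>

lemma limit_dens_infinite_df_le_1: "limit_dens_infinite_df c v x \<le> 1"
proof -
  have "phi a * (1 + t) \<le> 1 * 2" if "\<bar>t\<bar> \<le> 1" for a t :: real
    using that std_normal_density_le_1[of a] by (intro mult_mono) auto
  from this[OF abs_t_fun_le[of v c x], of "z_plus v c x"] this[of "- t_fun v c x" "z_minus v c x"] abs_t_fun_le[of v c x]
  show ?thesis by (auto simp: limit_dens_infinite_df_def of_bool_def)
qed

lemma measurable_of_bool_order [measurable]:
  fixes f g :: "'a \<Rightarrow> real"
  assumes [measurable]: "f \<in> borel_measurable M" "g \<in> borel_measurable M"
  shows "(\<lambda>x. of_bool (f x < g x) :: real) \<in> borel_measurable M"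
    "(\<lambda>x. of_bool (f x \<le> g x) :: real) \<in> borel_measurable M"
  unfolding of_bool_def by measurable

lemma measurable_Phi [measurable]: "Phi \<in> borel_measurable borel"
  by (intro borel_measurable_continuous_onI continuous_at_imp_continuous_on ballI continuous_Phi)

lemma measurable_z_plus_z_minus_t_fun [measurable]:
  assumes [measurable]: "f \<in> borel_measurable M" "g \<in> borel_measurable M"
  shows "(\<lambda>x. z_plus v (f x) (g x)) \<in> borel_measurable M"
   "(\<lambda>x. z_minus v (f x) (g x)) \<in> borel_measurable M"
   "(\<lambda>x. t_fun v (f x) (g x)) \<in> borel_measurable M"
  unfolding z_plus_def z_minus_def t_fun_def by measurable

lemma measurable_limit_dens_infinite_df [measurable]:
  assumes [measurable]: "f \<in> borel_measurable M" "g \<in> borel_measurable M"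
  shows "(\<lambda>x. limit_dens_infinite_df (f x) v (g x)) \<in> borel_measurable M"
  unfolding limit_dens_infinite_df_def by measurable

lemma measurable_limit_cdf_infinite_df [measurable]:
  assumes [measurable]: "f \<in> borel_measurable M" "g \<in> borel_measurable M"
  shows "(\<lambda>x. limit_cdf_infinite_df (f x) v (g x)) \<in> borel_measurable M"
  unfolding limit_cdf_infinite_df_def by measurable

lemma measurable_limit_atom_infinite_df [measurable]:
  assumes [measurable]: "f \<in> borel_measurable M"
  shows "(\<lambda>x. limit_atom_infinite_df (f x) v) \<in> borel_measurable M"
  unfolding limit_atom_infinite_df_def by measurable

text \<open>The factors \<open>1 \<plusminus> t\<close> of the limit density are the inner derivatives of \<open>Phi (z_plus v c x)\<close> and
\<open>Phi (z_minus v c x)\<close>. For \<open>c = 0\<close> the square root has a kink at \<open>- v\<close>.\<close>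

lemma DERIV_z_plus_z_minus:
  assumes "c \<noteq> 0"
  shows "(z_plus v c has_real_derivative (1 + t_fun v c x) / 2) (at x)"
    "(z_minus v c has_real_derivative (1 - t_fun v c x) / 2) (at x)"
proof -
  have pos: "0 < ((x + v) / 2)\<^sup>2 + c\<^sup>2" using assms by (simp add: add_nonneg_pos)
  have "(x + v)\<^sup>2 + 4 * c\<^sup>2 = 4 * (((x + v) / 2)\<^sup>2 + c\<^sup>2)" by (simp add: power2_eq_square field_simps)
  then have eq: "sqrt ((x + v)\<^sup>2 + 4 * c\<^sup>2) = 2 * sqrt (((x + v) / 2)\<^sup>2 + c\<^sup>2)"
    by (simp only: real_sqrt_mult) simp
  have "((\<lambda>x. sqrt (((x + v) / 2)\<^sup>2 + c\<^sup>2)) has_real_derivative t_fun v c x / 2) (at x)"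
  proof -
    have "((\<lambda>x. ((x + v) / 2)\<^sup>2 + c\<^sup>2) has_real_derivative (x + v) / 2) (at x)"
      by (auto intro!: derivative_eq_intros simp: field_simps)
    from DERIV_chain2[OF DERIV_real_sqrt[OF pos] this] show ?thesis
      unfolding t_fun_def eq by (simp add: field_simps)
  qed
  note d = this
  have l: "((\<lambda>x. (x - v) / 2) has_real_derivative 1 / 2) (at x)"
    by (auto intro!: derivative_eq_intros)
  show "(z_plus v c has_real_derivative (1 + t_fun v c x) / 2) (at x)"
    unfolding z_plus_alt[abs_def] using DERIV_add[OF l d] by (simp add: add_divide_distrib)
  show "(z_minus v c has_real_derivative (1 - t_fun v c x) / 2) (at x)"
    unfolding z_minus_alt[abs_def] using DERIV_diff[OF l d] by (simp add: diff_divide_distrib)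
qed

lemma nn_integral_limit_dens_right:
  assumes c: "0 < c" and x: "- v \<le> x"
  shows "(\<integral>\<^sup>+y. ennreal (limit_dens_infinite_df c v y) * indicator {x<..} y \<partial>lborel) = ennreal (1 - Phi (z_plus v c x))"
proof -
  let ?g = "\<lambda>y. phi (z_plus v c y) * ((1 + t_fun v c y) / 2)"
  have "(\<integral>\<^sup>+y. ennreal (limit_dens_infinite_df c v y) * indicator {x<..} y \<partial>lborel) =
      (\<integral>\<^sup>+y. ennreal (?g y) * indicator {x..} y \<partial>lborel)"
  proof (rule nn_integral_cong_AE)
    have "AE y in lborel. y \<noteq> x" by (rule AE_lborel_singleton)
    then show "AE y in lborel. ennreal (limit_dens_infinite_df c v y) * indicator {x<..} y = ennreal (?g y) * indicator {x..} y"
      by eventually_elim (use x in \<open>auto simp: limit_dens_infinite_df_def split: split_indicator\<close>)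
  qed
  also have "\<dots> = ennreal (1 - Phi (z_plus v c x))"
  proof (rule nn_integral_FTC_atLeast)
    show "((\<lambda>x. Phi (z_plus v c x)) has_real_derivative ?g y) (at y)" for y
      using c by (intro DERIV_Phi DERIV_z_plus_z_minus) simp
    show "0 \<le> ?g y" for y using abs_t_fun_le[of v c y] by auto
    have "filterlim (z_plus v c) at_top at_top"
    proof (rule filterlim_at_top_mono)
      show "filterlim (\<lambda>y. y) at_top at_top" by (rule filterlim_ident)
      have "y \<le> z_plus v c y" for y
      proof -
        have "(y + v) / 2 \<le> sqrt (((y + v) / 2)\<^sup>2 + c\<^sup>2)" by (rule real_le_rsqrt) simp
        moreover have "b / 2 \<le> S \<Longrightarrow> b = y + v \<Longrightarrow> y \<le> (y - v) / 2 + S" for b S :: real by (simp add: field_simps)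
        ultimately show ?thesis unfolding z_plus_alt by blast
      qed
      then show "eventually (\<lambda>y. y \<le> z_plus v c y) at_top" by simp
    qed
    then show "((\<lambda>x. Phi (z_plus v c x)) \<longlongrightarrow> 1) at_top"
      by (rule filterlim_compose[OF std_normal.cdf_lim_at_top_prob])
  qed measurable
  finally show ?thesis .
qed

lemma nn_integral_limit_dens_left:
  assumes c: "0 < c" and x: "x \<le> - v"
  shows "(\<integral>\<^sup>+y. ennreal (limit_dens_infinite_df c v y) * indicator {x<..- v} y \<partial>lborel) = ennreal (Phi (- v - c) - Phi (z_minus v c x))"
proof -
  let ?g = "\<lambda>y. phi (z_minus v c y) * ((1 - t_fun v c y) / 2)"
  have "(\<integral>\<^sup>+y. ennreal (limit_dens_infinite_df c v y) * indicator {x<..- v} y \<partial>lborel) =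
      (\<integral>\<^sup>+y. ennreal (?g y) * indicator {x..- v} y \<partial>lborel)"
  proof (rule nn_integral_cong_AE)
    have "AE y in lborel. y \<noteq> x" "AE y in lborel. y \<noteq> - v" by (rule AE_lborel_singleton)+
    then show "AE y in lborel. ennreal (limit_dens_infinite_df c v y) * indicator {x<..- v} y = ennreal (?g y) * indicator {x..- v} y"
      by eventually_elim (use x in \<open>auto simp: limit_dens_infinite_df_def split: split_indicator\<close>)
  qed
  also have "\<dots> = ennreal (Phi (z_minus v c (- v)) - Phi (z_minus v c x))"
  proof (rule nn_integral_FTC_Icc)
    show "((\<lambda>x. Phi (z_minus v c x)) has_real_derivative ?g y) (at y)" for y
      using c by (intro DERIV_Phi DERIV_z_plus_z_minus) simp
    show "0 \<le> ?g y" for y using abs_t_fun_le[of v c y] by auto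
    show "?g \<in> borel_measurable borel" by measurable
  qed (use x in simp)
  also have "z_minus v c (- v) = - v - c" using c by (simp add: z_minus_def)
  finally show ?thesis .
qed

text \<open>Both measures are finite, so it is enough to compare them on the half-lines \<open>{x<..}\<close>. A half-line that
contains \<open>- v\<close> is cut there, since the distribution function switches from \<open>z_minus\<close> to
\<open>z_plus\<close>; the jump at the cut is exactly the mass of the atom.\<close>

lemma limit_law_off_atom:
  assumes c: "0 < c"
  shows "density (limit_law v c) (indicator (- {- v})) = density lborel (limit_dens_infinite_df c v)"
    (is "?L = ?R")
proof (rule measure_eqI_lessThan)
  interpret L: real_distribution "limit_law v c" by (rule real_distribution_limit_law)
  show "sets ?L = sets borel" "sets ?R = sets borel" by auto
  have em: "emeasure ?L {x<..} = emeasure (limit_law v c) ({x<..} - {- v})" for x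
    by (subst emeasure_density) (auto simp: nn_integral_indicator[symmetric] indicator_inter_arith[symmetric] simp del: nn_integral_indicator intro!: nn_integral_cong split: split_indicator)
  then show "emeasure ?L {x<..} < \<infinity>" for x by (simp add: L.emeasure_eq_measure)
  have gt: "measure (limit_law v c) {x<..} = 1 - limit_cdf_infinite_df c v x" for x
  proof -
    have "measure (limit_law v c) (UNIV - {..x}) = 1 - limit_cdf_infinite_df c v x"
      using c L.prob_space by (subst L.finite_measure_Diff) (auto simp: cdf_limit_law[symmetric] cdf_def)
    also have "UNIV - {..x} = {x<..}" by auto
    finally show ?thesis .
  qed
  show "emeasure ?L {x<..} = emeasure ?R {x<..}" for x
  proof (cases "- v \<le> x")
    case True
    then have "{x<..} - {- v} = {x<..}" by auto
    then show ?thesis using True c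
      by (simp add: em emeasure_density L.emeasure_eq_measure gt nn_integral_limit_dens_right limit_cdf_infinite_df_def)
  next
    case False
    have "emeasure ?R {x<..} = (\<integral>\<^sup>+y. ennreal (limit_dens_infinite_df c v y) * indicator {x<..- v} y +
        ennreal (limit_dens_infinite_df c v y) * indicator {- v<..} y \<partial>lborel)"
      using False by (subst emeasure_density) (auto intro!: nn_integral_cong split: split_indicator)
    also have "\<dots> = ennreal (Phi (- v - c) - Phi (z_minus v c x)) + ennreal (1 - Phi (z_plus v c (- v)))"
      using False c by (subst nn_integral_add) (auto simp: nn_integral_limit_dens_right nn_integral_limit_dens_left)
    also have "z_plus v c (- v) = - v + c" using c by (simp add: z_plus_def)
    also have "ennreal (Phi (- v - c) - Phi (z_minus v c x)) + ennreal (1 - Phi (- v + c)) =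
       ennreal (Phi (- v - c) - Phi (z_minus v c x) + (1 - Phi (- v + c)))"
    proof (rule ennreal_plus[symmetric])
      have "z_minus v c x \<le> - v - c"
      proof -
        have "c \<le> sqrt (((x + v) / 2)\<^sup>2 + c\<^sup>2)" using c by (simp add: real_le_rsqrt)
        moreover have "c \<le> S \<Longrightarrow> (x - v) / 2 - S \<le> - v - c" for S :: real using False by (simp add: field_simps)
        ultimately show ?thesis unfolding z_minus_alt by blast
      qed
      then show "0 \<le> Phi (- v - c) - Phi (z_minus v c x)" using std_normal.cdf_nondecreasing by simp
      show "0 \<le> 1 - Phi (- v + c)" using std_normal.cdf_bounded_prob by simp
    qed
    also have "\<dots> = ennreal (measure (limit_law v c) ({x<..} - {- v}))"
      using False c by (subst L.finite_measure_Diff) (auto simp: gt measure_limit_law_atom limit_cdf_infinite_df_def limit_atom_infinite_df_def intro!: arg_cong[where f=ennreal])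
    finally show ?thesis by (simp add: em L.emeasure_eq_measure)
  qed
qed

lemma emeasure_limit_law:
  assumes c: "0 \<le> c" and A: "A \<in> sets borel"
  shows "emeasure (limit_law v c) A = ennreal (limit_atom_infinite_df c v) * emeasure (return borel (- v)) A
    + (\<integral>\<^sup>+x\<in>A. ennreal (limit_dens_infinite_df c v x) \<partial>lborel)"
proof (cases "c = 0")
  case True
  have "emeasure (limit_law v c) A = (\<integral>\<^sup>+x. ennreal (phi x) * indicator A x \<partial>lborel)"
    using A True by (simp add: limit_law_0 emeasure_density)
  also have "\<dots> = (\<integral>\<^sup>+x\<in>A. ennreal (limit_dens_infinite_df c v x) \<partial>lborel)"
  proof (rule nn_integral_cong_AE)
    have sq: "sqrt (((x + v) / 2)\<^sup>2 + 0\<^sup>2) = \<bar>x + v\<bar> / 2" "sqrt ((x + v)\<^sup>2 + 4 * 0\<^sup>2) = \<bar>x + v\<bar>" for x :: real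
      by (auto simp: power_mult_distrib real_sqrt_mult real_sqrt_divide power_divide)
    have dens: "limit_dens_infinite_df 0 v x = phi x" if "x \<noteq> - v" for x
    proof (cases "0 < x + v")
      case True
      then have "z_plus v 0 x = x" "t_fun v 0 x = 1" unfolding z_plus_alt t_fun_def sq by (auto simp: field_simps)
      with True show ?thesis by (simp add: limit_dens_infinite_df_def)
    next
      case False
      with that have neg: "x + v < 0" by simp
      then have "z_minus v 0 x = x" "t_fun v 0 x = - 1" unfolding z_minus_alt t_fun_def sq by (auto simp: field_simps)
      with neg show ?thesis by (simp add: limit_dens_infinite_df_def)
    qed
    have "AE y in lborel. y \<noteq> - v" by (rule AE_lborel_singleton)
    then show "AE x in lborel. ennreal (phi x) * indicator A x = ennreal (limit_dens_infinite_df c v x) * indicator A x"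
      by eventually_elim (simp add: True dens)
  qed
  finally show ?thesis using True by (simp add: limit_atom_infinite_df_def)
next
  case False
  with c have c: "0 < c" by simp
  interpret L: real_distribution "limit_law v c" by (rule real_distribution_limit_law)
  have "emeasure (limit_law v c) (A \<inter> {- v}) = ennreal (limit_atom_infinite_df c v) * emeasure (return borel (- v)) A"
  proof (cases "- v \<in> A")
    case True
    then have "A \<inter> {- v} = {- v}" by auto
    then show ?thesis using True A c by (simp add: L.emeasure_eq_measure measure_limit_law_atom)
  next
    case False
    then have "A \<inter> {- v} = {}" by auto
    then show ?thesis using False A by simp
  qed
  moreover have "emeasure (limit_law v c) (A - {- v}) = emeasure (density (limit_law v c) (indicator (- {- v}))) A"
    using A by (subst emeasure_density) (auto simp: nn_integral_indicator[symmetric] simp del: nn_integral_indicator intro!: nn_integral_cong split: split_indicator)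
  moreover have "\<dots> = (\<integral>\<^sup>+x\<in>A. ennreal (limit_dens_infinite_df c v x) \<partial>lborel)"
    unfolding limit_law_off_atom[OF c] using A by (subst emeasure_density) auto
  moreover have "emeasure (limit_law v c) A = emeasure (limit_law v c) (A \<inter> {- v}) + emeasure (limit_law v c) (A - {- v})"
    using A by (subst plus_emeasure) (auto intro!: arg_cong[where f="emeasure _"])
  ultimately show ?thesis by simp
qed

lemma limit_atom_infinite_df_nonneg: "0 \<le> c \<Longrightarrow> 0 \<le> limit_atom_infinite_df c v"
  using measure_limit_law_atom[of c v] by (metis measure_nonneg)

lemma is_atom_plus_density_limit_law:
  assumes "0 \<le> c"
  shows "is_atom_plus_density (limit_law v c) (limit_atom_infinite_df c v) (- v) (limit_dens_infinite_df c v)"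
proof -
  have "limit_dens_infinite_df c v \<in> borel_measurable borel" by measurable
  moreover have "sets (limit_law v c) = sets borel" by (simp add: limit_law_def)
  ultimately show ?thesis using assms emeasure_limit_law[OF assms] limit_dens_infinite_df_nonneg
      limit_atom_infinite_df_nonneg[OF assms] unfolding is_atom_plus_density_def by blast
qed

section \<open>The law of the standardised residual scale\<close>

definition chi_law :: "nat \<Rightarrow> real measure" where
  "chi_law m = distr (chi_square_distribution m) borel (\<lambda>q. sqrt q / sqrt (real m))"

abbreviation std_normal_product :: "nat \<Rightarrow> (nat \<Rightarrow> real) measure" where
  "std_normal_product m \<equiv> \<Pi>\<^sub>M j\<in>{..<m}. std_normal_distribution"

interpretation std_normal_product: product_prob_space "\<lambda>_::nat. std_normal_distribution" UNIV
  by standard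

lemma prob_space_std_normal_product: "prob_space (std_normal_product m)"
  by (rule prob_space_PiM) (rule std_normal.prob_space_axioms)

lemma measurable_std_normal_component:
  "j \<in> I \<Longrightarrow> (\<lambda>z. z j) \<in> borel_measurable (\<Pi>\<^sub>M j\<in>I. std_normal_distribution)"
  using measurable_component_singleton[of j I "\<lambda>_. std_normal_distribution"] by simp

lemma measurable_sum_squares [measurable]:
  "(\<lambda>z. \<Sum>j<m. (z j)\<^sup>2) \<in> borel_measurable (std_normal_product m)"
  by (intro borel_measurable_sum borel_measurable_power measurable_std_normal_component) auto

lemma chi_law_eq: "chi_law m = distr (std_normal_product m) borel (\<lambda>z. sqrt (\<Sum>j<m. (z j)\<^sup>2) / sqrt (real m))"
  unfolding chi_law_def chi_square_distribution_def by (subst distr_distr) (auto simp: comp_def)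

lemma real_distribution_chi_law: "real_distribution (chi_law m)"
  unfolding chi_law_eq by (rule prob_space.real_distribution_distr[OF prob_space_std_normal_product]) measurable

lemma AE_chi_law_nonneg: "AE s in chi_law m. 0 \<le> s"
proof -
  have "AE z in std_normal_product m. 0 \<le> sqrt (\<Sum>j<m. (z j)\<^sup>2) / sqrt (real m)"
    by (rule AE_I2) (simp add: sum_nonneg)
  then show ?thesis unfolding chi_law_eq by (subst AE_distr_iff) simp_all
qed

text \<open>For fixed \<open>w\<close> the map \<open>y \<mapsto> sqrt (w + y\<^sup>2) / sqrt m\<close> has, away from zero, the two differentiable
inverse branches \<open>s \<mapsto> \<plusminus> sqrt (m * s\<^sup>2 - w)\<close>, and differentiable maps send null sets to null sets.\<close>

lemma null_preimage_root_square_plus: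
  fixes w :: real
  assumes m: "0 < m" and w: "0 \<le> w" and A: "A \<in> null_sets lborel"
  shows "AE y in std_normal_distribution. sqrt (w + y\<^sup>2) / sqrt (real m) \<notin> A"
proof -
  let ?g = "\<lambda>y. sqrt (w + y\<^sup>2) / sqrt (real m)"
  let ?S = "A \<inter> {s. w < real m * s\<^sup>2}"
  let ?h = "\<lambda>s. sqrt (real m * s\<^sup>2 - w)"
  have [measurable]: "A \<in> sets borel" using A by auto
  have "negligible A" using A by (simp add: negligible_iff_null_sets null_sets_completionI)
  then have "negligible ?S" by (rule negligible_subset) auto
  moreover have "?h differentiable_on ?S"
    unfolding differentiable_on_def
  proof
    fix s assume "s \<in> ?S"
    then have "0 < real m * s\<^sup>2 - w" by simp
    from DERIV_real_sqrt[OF this]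
    have "((\<lambda>s. sqrt (real m * s\<^sup>2 - w)) has_real_derivative (inverse (sqrt (real m * s\<^sup>2 - w)) / 2) * (real m * (2 * s))) (at s)"
      by (rule DERIV_chain2) (auto intro!: derivative_eq_intros)
    then show "?h differentiable (at s within ?S)"
      using differentiable_at_withinI real_differentiable_def by blast
  qed
  ultimately have neg: "negligible (?h ` ?S)"
    by (rule negligible_differentiable_image_negligible[OF order_refl])
  have "negligible ((\<lambda>x. - x) ` (?h ` ?S))"
    by (rule negligible_differentiable_image_negligible[OF order_refl neg])
       (auto simp: differentiable_on_def intro!: differentiable_minus)
  with neg have "negligible (insert 0 (?h ` ?S \<union> (\<lambda>x. - x) ` (?h ` ?S)))" by auto
  moreover have "{y. ?g y \<in> A} \<subseteq> insert 0 (?h ` ?S \<union> (\<lambda>x. - x) ` (?h ` ?S))"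
  proof
    fix y assume "y \<in> {y. ?g y \<in> A}"
    then have y: "?g y \<in> A" by simp
    have eq: "real m * (?g y)\<^sup>2 = w + y\<^sup>2" using m w by (simp add: power_divide)
    show "y \<in> insert 0 (?h ` ?S \<union> (\<lambda>x. - x) ` (?h ` ?S))"
    proof (cases "y = 0")
      case False
      then have "?g y \<in> ?S" using y eq by simp
      moreover have "?h (?g y) = \<bar>y\<bar>" unfolding eq by simp
      ultimately have "\<bar>y\<bar> \<in> ?h ` ?S" by (metis (no_types, lifting) imageI)
      moreover have "y = \<bar>y\<bar> \<or> y = - \<bar>y\<bar>" by auto
      ultimately show ?thesis by (metis (no_types, lifting) Un_iff imageI insertCI)
    qed simp
  qed
  ultimately have "negligible {y. ?g y \<in> A}" by (rule negligible_subset)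
  moreover have "{y. ?g y \<in> A} \<in> sets lborel" by measurable
  ultimately have "{y. ?g y \<in> A} \<in> null_sets lborel"
    by (simp add: negligible_iff_null_sets null_sets_completion_iff)
  then have "AE y in lborel. ?g y \<notin> A" using AE_not_in by fastforce
  then show ?thesis by (subst AE_density) auto
qed

text \<open>One of the squared coordinates is enough: given the other \<open>m - 1\<close> coordinates, the preimage
of a null set is null, and Tonelli's theorem integrates this over them.\<close>

lemma absolutely_continuous_chi_law:
  assumes "0 < m" shows "absolutely_continuous lborel (chi_law m)"
proof -
  obtain k where m: "m = Suc k" using assms by (cases m) auto
  have "emeasure (chi_law m) A = 0" if A: "A \<in> null_sets lborel" for A
  proof -
    have [measurable]: "A \<in> sets borel" using A by auto
    let ?f = "\<lambda>z. indicator A (sqrt (\<Sum>j<m. (z j)\<^sup>2) / sqrt (real m)) :: ennreal"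
    have "emeasure (chi_law m) A = (\<integral>\<^sup>+s. indicator A s \<partial>chi_law m)"
      by (simp add: chi_law_eq)
    also have "\<dots> = (\<integral>\<^sup>+z. ?f z \<partial>std_normal_product m)"
      unfolding chi_law_eq by (subst nn_integral_distr) auto
    also have "\<dots> = (\<integral>\<^sup>+z. ?f z \<partial>(\<Pi>\<^sub>M j\<in>insert k {..<k}. std_normal_distribution))"
      by (simp add: m lessThan_Suc)
    also have "\<dots> = (\<integral>\<^sup>+z. (\<integral>\<^sup>+y. ?f (z(k := y)) \<partial>std_normal_distribution) \<partial>std_normal_product k)"
    proof (rule std_normal_product.product_nn_integral_insert)
      have "?f \<in> borel_measurable (std_normal_product m)" by measurable
      then show "?f \<in> borel_measurable (\<Pi>\<^sub>M j\<in>insert k {..<k}. std_normal_distribution)"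
        by (simp add: m lessThan_Suc)
    qed auto
    also have "\<dots> = (\<integral>\<^sup>+z. 0 \<partial>std_normal_product k)"
    proof (rule nn_integral_cong)
      fix z :: "nat \<Rightarrow> real"
      have eq: "(\<Sum>j<m. ((z(k := y)) j)\<^sup>2) = (\<Sum>j<k. (z j)\<^sup>2) + y\<^sup>2" for y
        by (simp add: m lessThan_Suc)
      have "AE y in std_normal_distribution. sqrt ((\<Sum>j<k. (z j)\<^sup>2) + y\<^sup>2) / sqrt (real m) \<notin> A"
        by (rule null_preimage_root_square_plus) (use assms A in \<open>auto intro: sum_nonneg\<close>)
      then have "(\<integral>\<^sup>+y. ?f (z(k := y)) \<partial>std_normal_distribution) = (\<integral>\<^sup>+y. 0 \<partial>std_normal_distribution)"
        unfolding eq by (intro nn_integral_cong_AE) (auto elim!: eventually_mono)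
      then show "(\<integral>\<^sup>+y. ?f (z(k := y)) \<partial>std_normal_distribution) = 0" by simp
    qed
    finally show ?thesis by simp
  qed
  moreover have "sets (chi_law m) = sets borel" by (simp add: chi_law_eq)
  ultimately show ?thesis unfolding absolutely_continuous_def by (auto intro!: null_setsI)
qed

lemma measurable_rho [measurable]: "rho m \<in> borel_measurable borel"
proof -
  have [measurable]: "RN_deriv lborel (chi_law m) \<in> borel_measurable borel"
    using borel_measurable_RN_deriv[of lborel "chi_law m"] by simp
  show ?thesis unfolding rho_def[abs_def] chi_law_def[symmetric] by measurable
qed

lemma rho_nonneg: "0 \<le> rho m s"
  by (simp add: rho_def)

text \<open>The Radon-Nikodym derivative may be infinite or positive at negative arguments on a null set, where
\<open>rho\<close> differs from it.\<close>

lemma chi_law_eq_density: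
  assumes "0 < m"
  shows "chi_law m = density lborel (\<lambda>s. ennreal (rho m s))"
proof -
  interpret real_distribution "chi_law m" by (rule real_distribution_chi_law)
  let ?r = "RN_deriv lborel (chi_law m)"
  have ac: "absolutely_continuous lborel (chi_law m)" using assms by (rule absolutely_continuous_chi_law)
  have s: "sets (chi_law m) = sets lborel" by (simp add: chi_law_eq)
  have d: "density lborel ?r = chi_law m" using ac s by (rule sigma_finite_measure.density_RN_deriv[OF sigma_finite_lborel])
  have "AE s in density lborel ?r. 0 \<le> s" unfolding d by (rule AE_chi_law_nonneg)
  then have neg: "AE s in lborel. 0 < ?r s \<longrightarrow> 0 \<le> s" by (subst (asm) AE_density) auto
  have "AE s in lborel. ?r s \<noteq> \<infinity>"
    by (rule sigma_finite_measure.RN_deriv_finite[OF sigma_finite_lborel _ ac s]) (rule sigma_finite_measure_axioms)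
  with neg have "AE s in lborel. ?r s = ennreal (rho m s)"
  proof eventually_elim
    case (elim s)
    then show ?case by (auto simp: rho_def chi_law_def[symmetric] less_top zero_less_iff_neq_zero)
  qed
  then have "density lborel ?r = density lborel (\<lambda>s. ennreal (rho m s))"
    by (intro density_cong) auto
  with d show ?thesis by simp
qed

lemma integral_chi_law:
  assumes "0 < m" and [measurable]: "g \<in> borel_measurable borel"
  shows "integral\<^sup>L (chi_law m) g = (LBINT s:{0..}. g s * rho m s)"
proof -
  have "integral\<^sup>L (chi_law m) g = (LBINT s. rho m s *\<^sub>R g s)"
    unfolding chi_law_eq_density[OF assms(1)] by (rule integral_density) (auto simp: rho_nonneg)
  also have "\<dots> = (LBINT s:{0..}. g s * rho m s)"
    unfolding set_lebesgue_integral_def by (intro Bochner_Integration.integral_cong) (auto simp: rho_def split: split_indicator)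
  finally show ?thesis .
qed

section \<open>The limit law for fixed degrees of freedom\<close>

text \<open>The law of \<open>soft_threshold (D * e) (Z + v) - v\<close> for a standard normal \<open>Z\<close> and an independent \<open>D\<close>
with law \<open>K\<close>. It serves both as the exact law of the scaled estimation error and as its limit.\<close>

definition mixed_limit_law :: "real \<Rightarrow> real \<Rightarrow> real measure \<Rightarrow> real measure" where
  "mixed_limit_law v e K = distr (std_normal_distribution \<Otimes>\<^sub>M K) borel (\<lambda>(z, d). soft_threshold (d * e) (z + v) - v)"

lemma measurable_mixed_map:
  assumes "sets K = sets borel"
  shows "(\<lambda>(z, d). soft_threshold (d * e) (z + v) - v) \<in> borel_measurable (std_normal_distribution \<Otimes>\<^sub>M K)"
proof -
  have "sets (std_normal_distribution \<Otimes>\<^sub>M K) = sets (borel \<Otimes>\<^sub>M borel)"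
    using assms by (intro sets_pair_measure_cong) auto
  moreover have "(\<lambda>(z, d). soft_threshold (d * e) (z + v) - v) \<in> borel_measurable (borel \<Otimes>\<^sub>M borel)"
    by measurable
  ultimately show ?thesis using measurable_cong_sets by blast
qed

lemma real_distribution_mixed_limit_law:
  assumes "real_distribution K" shows "real_distribution (mixed_limit_law v e K)"
proof -
  interpret K: real_distribution K by fact
  interpret pair_prob_space std_normal_distribution K by standard
  show ?thesis unfolding mixed_limit_law_def
    by (rule real_distribution_distr) (rule measurable_mixed_map, simp)
qed

lemma emeasure_mixed_limit_law:
  assumes "real_distribution K" and A: "A \<in> sets borel"
  shows "emeasure (mixed_limit_law v e K) A = (\<integral>\<^sup>+d. emeasure (limit_law v (d * e)) A \<partial>K)"
proof -
  interpret K: real_distribution K by fact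
  interpret pair_prob_space std_normal_distribution K by standard
  have m: "(\<lambda>(z, d). soft_threshold (d * e) (z + v) - v) \<in> borel_measurable (std_normal_distribution \<Otimes>\<^sub>M K)"
    by (rule measurable_mixed_map) simp
  have "emeasure (mixed_limit_law v e K) A = (\<integral>\<^sup>+d. emeasure std_normal_distribution
      ((\<lambda>z. (z, d)) -` ((\<lambda>(z, d). soft_threshold (d * e) (z + v) - v) -` A \<inter> space (std_normal_distribution \<Otimes>\<^sub>M K))) \<partial>K)"
    unfolding mixed_limit_law_def emeasure_distr[OF m A]
    by (rule emeasure_pair_measure_alt2) (rule measurable_sets[OF m A])
  also have "\<dots> = (\<integral>\<^sup>+d. emeasure (limit_law v (d * e)) A \<partial>K)"
    unfolding limit_law_def using A
    by (intro nn_integral_cong) (auto simp: emeasure_distr space_pair_measure vimage_def)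
  finally show ?thesis .
qed

lemma mixed_limit_law_0:
  assumes "real_distribution K" shows "mixed_limit_law v 0 K = std_normal_distribution"
proof (rule measure_eqI)
  interpret K: real_distribution K by fact
  show "sets (mixed_limit_law v 0 K) = sets std_normal_distribution" by (simp add: mixed_limit_law_def)
  fix A assume "A \<in> sets (mixed_limit_law v 0 K)"
  then have A: "A \<in> sets borel" by (simp add: mixed_limit_law_def)
  show "emeasure (mixed_limit_law v 0 K) A = emeasure std_normal_distribution A"
    using K.emeasure_space_1 by (simp add: emeasure_mixed_limit_law[OF assms A] limit_law_0)
qed

text \<open>A degenerate scale leaves a deterministic threshold. The identity goes through the
absolute value of the threshold because the closed form of the law, which supplies measurability
in \<open>d\<close>, is available for nonnegative thresholds only.\<close>

lemma mixed_limit_law_return: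
  "mixed_limit_law v e (return borel 1) = limit_law v e"
proof (rule measure_eqI)
  have rd: "real_distribution (return borel (1::real))"
    by (intro real_distribution.intro prob_space_return real_distribution_axioms.intro) auto
  show "sets (mixed_limit_law v e (return borel 1)) = sets (limit_law v e)" by (simp add: mixed_limit_law_def limit_law_def)
  fix A assume "A \<in> sets (mixed_limit_law v e (return borel 1))"
  then have A: "A \<in> sets borel" by (simp add: mixed_limit_law_def)
  have "(\<lambda>d. emeasure (limit_law v (d * e)) A) \<in> borel_measurable borel"
  proof -
    have *: "emeasure (limit_law v (d * e)) A = ennreal (limit_atom_infinite_df \<bar>d * e\<bar> v) * emeasure (return borel (- v)) A
    + (\<integral>\<^sup>+x\<in>A. ennreal (limit_dens_infinite_df \<bar>d * e\<bar> v x) \<partial>lborel)" for d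
      using emeasure_limit_law[of "\<bar>d * e\<bar>" A v] A by (simp add: limit_law_def soft_threshold_def)
    show ?thesis unfolding * using A by measurable
  qed
  then show "emeasure (mixed_limit_law v e (return borel 1)) A = emeasure (limit_law v e) A"
    by (simp add: emeasure_mixed_limit_law[OF rd A] nn_integral_return)
qed

lemma cdf_mixed_limit_law_chi:
  assumes m: "0 < m" and e: "0 \<le> e"
  shows "cdf (mixed_limit_law v e (chi_law m)) x = limit_cdf_fixed_df m e v x"
proof -
  interpret C: real_distribution "chi_law m" by (rule real_distribution_chi_law)
  interpret L: real_distribution "mixed_limit_law v e (chi_law m)"
    by (rule real_distribution_mixed_limit_law) (rule real_distribution_chi_law)
  have F01: "0 \<le> limit_cdf_infinite_df c v x" "limit_cdf_infinite_df c v x \<le> 1" for c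
    using std_normal.cdf_nonneg std_normal.cdf_bounded_prob by (auto simp: limit_cdf_infinite_df_def of_bool_def)
  have int: "integrable (chi_law m) (\<lambda>d. limit_cdf_infinite_df (d * e) v x)"
    by (rule C.integrable_const_bound[where B=1]) (auto simp: F01)
  have "ennreal (cdf (mixed_limit_law v e (chi_law m)) x) = (\<integral>\<^sup>+d. emeasure (limit_law v (d * e)) {..x} \<partial>chi_law m)"
    unfolding cdf_def L.emeasure_eq_measure[symmetric]
    by (rule emeasure_mixed_limit_law) (auto intro: real_distribution_chi_law)
  also have "\<dots> = (\<integral>\<^sup>+d. ennreal (limit_cdf_infinite_df (d * e) v x) \<partial>chi_law m)"
  proof (rule nn_integral_cong_AE)
    show "AE d in chi_law m. emeasure (limit_law v (d * e)) {..x} = ennreal (limit_cdf_infinite_df (d * e) v x)"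
      using AE_chi_law_nonneg
    proof eventually_elim
      case (elim d)
      interpret real_distribution "limit_law v (d * e)" by (rule real_distribution_limit_law)
      from elim show ?case using e cdf_limit_law[of "d * e" v x] by (simp add: emeasure_eq_measure cdf_def)
    qed
  qed
  also have "\<dots> = ennreal (LINT d|chi_law m. limit_cdf_infinite_df (d * e) v x)"
    by (rule nn_integral_eq_integral) (auto simp: int F01)
  finally have "cdf (mixed_limit_law v e (chi_law m)) x = (LINT d|chi_law m. limit_cdf_infinite_df (d * e) v x)"
    by (subst (asm) ennreal_inj) (auto simp: L.cdf_nonneg F01 intro!: integral_nonneg_AE)
  also have "\<dots> = (LBINT s:{0..}. limit_cdf_infinite_df (s * e) v x * rho m s)"
    by (rule integral_chi_law) (use m in auto)
  also have "\<dots> = limit_cdf_fixed_df m e v x"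
    by (cases "0 \<le> x + v") (simp_all add: limit_cdf_infinite_df_def limit_cdf_fixed_df_def)
  finally show ?thesis .
qed

text \<open>Conditionally on the scale \<open>d\<close> the law has an atom and a density that are known explicitly; both are
averaged, the density by exchanging the integrals over \<open>d\<close> and \<open>x\<close>. The scale is nonnegative almost
surely, which the closed forms need for the sign of the threshold \<open>d * e\<close>.\<close>

lemma is_atom_plus_density_mixed_limit_law_chi:
  assumes m: "0 < m" and e: "0 \<le> e"
  shows "is_atom_plus_density (mixed_limit_law v e (chi_law m)) (limit_atom_fixed_df m e v) (- v) (limit_dens_fixed_df m e v)"
proof -
  interpret C: real_distribution "chi_law m" by (rule real_distribution_chi_law)
  let ?a = "\<lambda>d. limit_atom_infinite_df (d * e) v" and ?f = "\<lambda>d x. limit_dens_infinite_df (d * e) v x"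
  have nonneg: "AE d in chi_law m. 0 \<le> ?a d"
    using AE_chi_law_nonneg by eventually_elim (use e in \<open>auto intro: limit_atom_infinite_df_nonneg\<close>)
  have atom: "limit_atom_fixed_df m e v = (LINT d|chi_law m. ?a d)"
    unfolding limit_atom_fixed_df_def limit_atom_infinite_df_def
    by (rule integral_chi_law[symmetric]) (use m in auto)
  have dens: "limit_dens_fixed_df m e v x = (LINT d|chi_law m. ?f d x)" for x
  proof -
    have "(LINT d|chi_law m. ?f d x) = 0.5 * (LINT d|chi_law m. 2 * ?f d x)" by simp
    also have "(LINT d|chi_law m. 2 * ?f d x) = (LBINT s:{0..}. (\<lambda>s. 2 * ?f s x) s * rho m s)"
      by (rule integral_chi_law) (use m in auto)
    also have "(\<lambda>s. 2 * ?f s x) = (\<lambda>s. phi (z_plus v (s * e) x) * (1 + t_fun v (s * e) x) * of_bool (x + v > 0)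
       + phi (z_minus v (s * e) x) * (1 - t_fun v (s * e) x) * of_bool (x + v < 0))"
      by (simp add: limit_dens_infinite_df_def)
    finally show ?thesis unfolding limit_dens_fixed_df_def ..
  qed
  have inta: "integrable (chi_law m) ?a"
  proof (rule C.integrable_const_bound[where B=1])
    have "\<bar>Phi a - Phi b\<bar> \<le> 1" for a b
      using std_normal.cdf_nonneg[of a] std_normal.cdf_nonneg[of b] std_normal.cdf_bounded_prob[of a] std_normal.cdf_bounded_prob[of b] by linarith
    then show "AE d in chi_law m. norm (?a d) \<le> 1" by (simp add: limit_atom_infinite_df_def)
  qed auto
  have intf: "integrable (chi_law m) (\<lambda>d. ?f d x)" for x
    by (rule C.integrable_const_bound[where B=1]) (auto simp: limit_dens_infinite_df_nonneg limit_dens_infinite_df_le_1)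
  have a0: "0 \<le> limit_atom_fixed_df m e v" unfolding atom by (rule integral_nonneg_AE) (rule nonneg)
  have ennf: "(\<integral>\<^sup>+d. ennreal (?f d x) \<partial>chi_law m) = ennreal (limit_dens_fixed_df m e v x)" for x
    unfolding dens by (rule nn_integral_eq_integral) (auto simp: intf limit_dens_infinite_df_nonneg)
  have f0: "0 \<le> limit_dens_fixed_df m e v x" for x
    unfolding dens by (rule integral_nonneg_AE) (simp add: limit_dens_infinite_df_nonneg)
  interpret pair_sigma_finite lborel "chi_law m" by standard
  have sets_pair: "sets (borel \<Otimes>\<^sub>M chi_law m) = sets (borel \<Otimes>\<^sub>M borel)"
    by (intro sets_pair_measure_cong) auto
  have sets_pair': "sets (lborel \<Otimes>\<^sub>M chi_law m) = sets (borel \<Otimes>\<^sub>M borel)"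
    by (intro sets_pair_measure_cong) auto
  have meas: "(\<lambda>(x, d). ?f d x) \<in> borel_measurable (borel \<Otimes>\<^sub>M borel)" by measurable
  have fm: "limit_dens_fixed_df m e v \<in> borel_measurable borel"
  proof -
    have "(\<lambda>x. LINT d|chi_law m. ?f d x) \<in> borel_measurable borel"
      using meas by (intro C.borel_measurable_lebesgue_integral) (simp cong: measurable_cong_sets add: sets_pair)
    then show ?thesis unfolding dens[abs_def, symmetric] by simp
  qed
  have "emeasure (mixed_limit_law v e (chi_law m)) A = ennreal (limit_atom_fixed_df m e v) * emeasure (return borel (- v)) A
        + (\<integral>\<^sup>+x\<in>A. ennreal (limit_dens_fixed_df m e v x) \<partial>lborel)" if A: "A \<in> sets borel" for A
  proof -
    have mA: "(\<lambda>(x, d). ennreal (?f d x) * indicator A x) \<in> borel_measurable (borel \<Otimes>\<^sub>M borel)"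
      using A by measurable
    have mA': "(\<lambda>d. \<integral>\<^sup>+x. ennreal (?f d x) * indicator A x \<partial>lborel) \<in> borel_measurable borel"
      using A by measurable
    have "emeasure (mixed_limit_law v e (chi_law m)) A = (\<integral>\<^sup>+d. emeasure (limit_law v (d * e)) A \<partial>chi_law m)"
      by (rule emeasure_mixed_limit_law) (auto intro: real_distribution_chi_law A)
    also have "\<dots> = (\<integral>\<^sup>+d. ennreal (?a d) * emeasure (return borel (- v)) A + (\<integral>\<^sup>+x. ennreal (?f d x) * indicator A x \<partial>lborel) \<partial>chi_law m)"
      by (intro nn_integral_cong_AE eventually_mono[OF AE_chi_law_nonneg] emeasure_limit_law) (use e A in auto)
    also have "\<dots> = (\<integral>\<^sup>+d. ennreal (?a d) \<partial>chi_law m) * emeasure (return borel (- v)) A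
       + (\<integral>\<^sup>+d. (\<integral>\<^sup>+x. ennreal (?f d x) * indicator A x \<partial>lborel) \<partial>chi_law m)"
      using mA' by (subst nn_integral_add) (auto simp: nn_integral_multc)
    also have "(\<integral>\<^sup>+d. ennreal (?a d) \<partial>chi_law m) = ennreal (limit_atom_fixed_df m e v)"
      unfolding atom by (rule nn_integral_eq_integral) (auto simp: inta nonneg)
    also have "(\<integral>\<^sup>+d. (\<integral>\<^sup>+x. ennreal (?f d x) * indicator A x \<partial>lborel) \<partial>chi_law m)
      = (\<integral>\<^sup>+x. (\<integral>\<^sup>+d. ennreal (?f d x) * indicator A x \<partial>chi_law m) \<partial>lborel)"
      using mA by (intro Fubini') (simp cong: measurable_cong_sets add: sets_pair')
    also have "\<dots> = (\<integral>\<^sup>+x\<in>A. ennreal (limit_dens_fixed_df m e v x) \<partial>lborel)"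
      by (intro nn_integral_cong) (simp add: nn_integral_multc ennf)
    finally show ?thesis .
  qed
  moreover have "sets (mixed_limit_law v e (chi_law m)) = sets borel" by (simp add: mixed_limit_law_def)
  ultimately show ?thesis unfolding is_atom_plus_density_def using a0 f0 fm by blast
qed

section \<open>A law of large numbers for the residual scale\<close>

text \<open>The squared sum is a double sum of products \<open>a (z i) * a (z j)\<close> with \<open>a x = x\<^sup>2 - 1\<close>. Each is a product over
all coordinates, with factor 1 at the coordinates that do not occur, so its expectation factorises: it is
zero for \<open>i \<noteq> j\<close>, and \<open>3 - 2 + 1\<close> on the diagonal by the second and fourth moments.\<close>

lemma second_moment_centred_chi_square:
  fixes m :: nat
  defines "S \<equiv> (\<lambda>z :: nat \<Rightarrow> real. \<Sum>j<m. ((z j)\<^sup>2 - 1))"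
  shows "integrable (std_normal_product m) (\<lambda>z. (S z)\<^sup>2)" (is ?int)
    and "(LINT z|std_normal_product m. (S z)\<^sup>2) = 2 * real m" (is ?eq)
proof -
  let ?N = "std_normal_distribution" and ?a = "\<lambda>x::real. x\<^sup>2 - 1"
  have int: "integrable ?N (\<lambda>x. x ^ k)" for k
    by (subst integrable_density) (auto intro: integrable_std_normal_moment)
  have mom: "(LINT x|?N. x ^ (2 * k)) = fact (2 * k) / (2 ^ k * fact k)" for k
    by (subst integral_density) (auto simp: integral_std_normal_moment_even)
  have a1: "integrable ?N ?a" using int[of 2] by auto
  have sq: "?a x * ?a x = x ^ 4 - 2 * x ^ 2 + 1" for x by (simp add: power2_eq_square power4_eq_xxxx algebra_simps)
  have a2: "integrable ?N (\<lambda>x. ?a x * ?a x)" unfolding sq using int[of 2] int[of 4] by auto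
  have m2: "(LINT x|?N. x\<^sup>2) = 1" using mom[of 1] by simp
  have m4: "(LINT x|?N. x ^ 4) = 3" using mom[of 2] by (simp add: fact_numeral)
  have Ea: "(LINT x|?N. ?a x) = 0"
    using int[of 2] std_normal.prob_space by (simp add: m2)
  have Eaa: "(LINT x|?N. ?a x * ?a x) = 2" unfolding sq
    using int[of 2] int[of 4] std_normal.prob_space by (simp add: m2 m4)
  \<comment> \<open>The factor of coordinate \<open>l\<close> in \<open>?a (z i) * ?a (z j)\<close>.\<close>
  let ?f = "\<lambda>i j l x. (if l = i then ?a x else 1) * (if l = j then ?a x else 1)"
  have fint: "integrable ?N (?f i j l)" for i j l
    using a1 a2 by (cases "l = i"; cases "l = j") simp_all
  have prod_eq: "(\<Prod>l<m. ?f i j l (z l)) = ?a (z i) * ?a (z j)" if "i < m" "j < m" for i j and z :: "nat \<Rightarrow> real"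
    using that by (simp add: prod.distrib)
  have pint: "integrable (std_normal_product m) (\<lambda>z. ?a (z i) * ?a (z j))" if "i < m" "j < m" for i j
    using std_normal_product.product_integrable_prod[of "{..<m}" "?f i j", OF _ fint]
    unfolding prod_eq[OF that] by simp
  have pE: "(LINT z|std_normal_product m. ?a (z i) * ?a (z j)) = (if i = j then 2 else 0)" if "i < m" "j < m" for i j
  proof -
    have "(LINT z|std_normal_product m. ?a (z i) * ?a (z j)) = (\<Prod>l<m. LINT x|?N. ?f i j l x)"
      using std_normal_product.product_integral_prod[of "{..<m}" "?f i j", OF _ fint]
      unfolding prod_eq[OF that] by simp
    also have "\<dots> = (if i = j then 2 else 0)"
    proof (cases "i = j")
      case True
      then have "(\<Prod>l<m. LINT x|?N. ?f i j l x) = (\<Prod>l<m. if l = i then 2 else 1)"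
        using Eaa std_normal.prob_space by (intro prod.cong) auto
      then show ?thesis using True that by simp
    next
      case False
      then have "(LINT x|?N. ?f i j i x) = 0" using Ea by simp
      with that have "\<exists>l\<in>{..<m}. (LINT x|?N. ?f i j l x) = 0" by (intro bexI[of _ i]) simp_all
      from prod_zero[OF finite_lessThan this] show ?thesis using False by simp
    qed
    finally show ?thesis .
  qed
  have S2: "(S z)\<^sup>2 = (\<Sum>i<m. \<Sum>j<m. ?a (z i) * ?a (z j))" for z
    unfolding S_def power2_eq_square[of "sum _ _"] sum_product ..
  show ?int unfolding S2 by (intro Bochner_Integration.integrable_sum pint) auto
  have "(LINT z|std_normal_product m. (S z)\<^sup>2) = (\<Sum>i<m. \<Sum>j<m. LINT z|std_normal_product m. ?a (z i) * ?a (z j))"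
    unfolding S2 by (subst Bochner_Integration.integral_sum, (intro Bochner_Integration.integrable_sum pint; simp))
      (intro sum.cong refl Bochner_Integration.integral_sum pint; simp)
  also have "\<dots> = (\<Sum>i<m. \<Sum>j<m. if i = j then 2 else 0)"
    by (intro sum.cong refl pE) auto
  finally show ?eq by simp
qed

text \<open>The root can be dropped since \<open>\<bar>d - 1\<bar> \<le> \<bar>d\<^sup>2 - 1\<bar>\<close> for \<open>d \<ge> 0\<close>; what remains is Chebyshev's inequality.\<close>

lemma chi_law_concentration:
  assumes m: "0 < m" and \<epsilon>: "0 < \<epsilon>"
  shows "measure (chi_law m) {s. \<epsilon> \<le> \<bar>s - 1\<bar>} \<le> 2 / (real m * \<epsilon>\<^sup>2)"
proof -
  interpret P: prob_space "std_normal_product m" by (rule prob_space_std_normal_product)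
  let ?S = "\<lambda>z :: nat \<Rightarrow> real. \<Sum>j<m. ((z j)\<^sup>2 - 1)" and ?D = "\<lambda>z :: nat \<Rightarrow> real. sqrt (\<Sum>j<m. (z j)\<^sup>2) / sqrt (real m)"
  have "measure (chi_law m) {s. \<epsilon> \<le> \<bar>s - 1\<bar>} = P.prob {z \<in> space (std_normal_product m). \<epsilon> \<le> \<bar>?D z - 1\<bar>}"
    unfolding chi_law_eq by (subst measure_distr) (auto simp: vimage_def Int_def conj_commute)
  also have "\<dots> \<le> P.prob {z \<in> space (std_normal_product m). (real m * \<epsilon>)\<^sup>2 \<le> (?S z)\<^sup>2}"
  proof (rule P.finite_measure_mono)
    show "{z \<in> space (std_normal_product m). \<epsilon> \<le> \<bar>?D z - 1\<bar>} \<subseteq> {z \<in> space (std_normal_product m). (real m * \<epsilon>)\<^sup>2 \<le> (?S z)\<^sup>2}"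
    proof safe
      fix z assume *: "\<epsilon> \<le> \<bar>?D z - 1\<bar>"
      have D0: "0 \<le> ?D z" by (simp add: sum_nonneg)
      have D2: "real m * ((?D z)\<^sup>2 - 1) = ?S z"
        using m by (simp add: power_divide sum_nonneg sum_subtractf field_simps)
      have "\<epsilon> * 1 \<le> \<bar>?D z - 1\<bar> * \<bar>?D z + 1\<bar>" using * D0 \<epsilon> by (intro mult_mono) auto
      also have "\<dots> = \<bar>(?D z)\<^sup>2 - 1\<bar>" unfolding abs_mult[symmetric] by (simp add: power2_eq_square algebra_simps)
      finally have "real m * \<epsilon> \<le> real m * \<bar>(?D z)\<^sup>2 - 1\<bar>" by (intro mult_left_mono) auto
      also have "\<dots> = \<bar>?S z\<bar>" unfolding D2[symmetric] by (simp add: abs_mult)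
      finally show "(real m * \<epsilon>)\<^sup>2 \<le> (?S z)\<^sup>2" using \<epsilon> by (intro abs_le_square_iff[THEN iffD1]) auto
    qed
    have "?S \<in> borel_measurable (std_normal_product m)"
      by (intro borel_measurable_sum borel_measurable_diff borel_measurable_power measurable_std_normal_component) auto
    then show "{z \<in> space (std_normal_product m). (real m * \<epsilon>)\<^sup>2 \<le> (?S z)\<^sup>2} \<in> P.events" by measurable
  qed
  also have "\<dots> \<le> (LINT z|std_normal_product m. (?S z)\<^sup>2) / (real m * \<epsilon>)\<^sup>2"
    \<comment> \<open>The rule asks for a measurable set \<open>A\<close> that does not occur in its conclusion.\<close>
    using m \<epsilon> by (intro integral_Markov_inequality_measure[where A="{}"] second_moment_centred_chi_square) auto
  also have "\<dots> = 2 / (real m * \<epsilon>\<^sup>2)"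
    unfolding second_moment_centred_chi_square(2) using m \<epsilon> by (simp add: power2_eq_square field_simps)
  finally show ?thesis .
qed

lemma weak_conv_chi_law:
  assumes m: "filterlim m at_top sequentially"
  shows "weak_conv_m (\<lambda>n. chi_law (m n)) (return borel 1)"
proof -
  have lim0: "(\<lambda>n. measure (chi_law (m n)) {s. \<epsilon> \<le> \<bar>s - 1\<bar>}) \<longlonglongrightarrow> 0" if \<epsilon>: "0 < \<epsilon>" for \<epsilon>
  proof (rule Lim_null_comparison)
    have "eventually (\<lambda>n. 1 \<le> m n) sequentially" using m by (simp add: filterlim_at_top)
    then show "eventually (\<lambda>n. norm (measure (chi_law (m n)) {s. \<epsilon> \<le> \<bar>s - 1\<bar>}) \<le> 2 / (real (m n) * \<epsilon>\<^sup>2)) sequentially"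
      by eventually_elim (use chi_law_concentration \<epsilon> in simp)
    have "filterlim (\<lambda>n. real (m n) * \<epsilon>\<^sup>2) at_infinity sequentially"
      using \<epsilon> by (intro filterlim_at_top_imp_at_infinity filterlim_at_top_mult_tendsto_pos[OF tendsto_const] filterlim_compose[OF filterlim_real_sequentially m]) auto
    then show "(\<lambda>n. 2 / (real (m n) * \<epsilon>\<^sup>2)) \<longlonglongrightarrow> 0"
      by (rule tendsto_divide_0[OF tendsto_const])
  qed
  show ?thesis unfolding weak_conv_m_def weak_conv_def
  proof safe
    fix x :: real assume cont: "isCont (cdf (return borel 1)) x"
    interpret R: real_distribution "return borel (1::real)"
      by (intro real_distribution.intro prob_space_return real_distribution_axioms.intro) auto
    have "x \<noteq> 1" using cont by (auto simp: R.isCont_cdf measure_return)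
    then consider "x < 1" | "1 < x" by linarith
    then show "(\<lambda>n. cdf (chi_law (m n)) x) \<longlonglongrightarrow> cdf (return borel 1) x"
    proof cases
      case 1
      have "(\<lambda>n. cdf (chi_law (m n)) x) \<longlonglongrightarrow> 0"
      proof (rule Lim_null_comparison[OF always_eventually lim0], rule allI)
        show "0 < 1 - x" using 1 by simp
        fix n
        interpret C: real_distribution "chi_law (m n)" by (rule real_distribution_chi_law)
        show "norm (cdf (chi_law (m n)) x) \<le> measure (chi_law (m n)) {s. 1 - x \<le> \<bar>s - 1\<bar>}"
          unfolding cdf_def real_norm_def abs_of_nonneg[OF measure_nonneg]
          by (rule C.finite_measure_mono) auto
      qed
      then show ?thesis using 1 by (simp add: cdf_def measure_return)
    next
      case 2
      have "(\<lambda>n. 1 - cdf (chi_law (m n)) x) \<longlonglongrightarrow> 0"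
      proof (rule Lim_null_comparison[OF always_eventually lim0], rule allI)
        show "0 < x - 1" using 2 by simp
        fix n
        interpret C: real_distribution "chi_law (m n)" by (rule real_distribution_chi_law)
        have "1 - cdf (chi_law (m n)) x = measure (chi_law (m n)) (UNIV - {..x})"
          unfolding cdf_def using C.prob_space by (subst C.finite_measure_Diff) auto
        also have "\<dots> \<le> measure (chi_law (m n)) {s. x - 1 \<le> \<bar>s - 1\<bar>}"
          by (rule C.finite_measure_mono) auto
        finally show "norm (1 - cdf (chi_law (m n)) x) \<le> measure (chi_law (m n)) {s. x - 1 \<le> \<bar>s - 1\<bar>}"
          using C.cdf_bounded_prob by simp
      qed
      then have "(\<lambda>n. 1 - (1 - cdf (chi_law (m n)) x)) \<longlonglongrightarrow> 1 - 0" by (intro tendsto_diff tendsto_const)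
      then show ?thesis using 2 by (simp add: cdf_def measure_return)
    qed
  qed
qed

section \<open>Passing to the limit\<close>

lemma weak_conv_m_cong_eventually:
  assumes "eventually (\<lambda>n. F n = G n) sequentially"
  shows "weak_conv_m F \<mu> \<longleftrightarrow> weak_conv_m G \<mu>"
proof -
  have "(\<lambda>n. cdf (F n) x) \<longlonglongrightarrow> l \<longleftrightarrow> (\<lambda>n. cdf (G n) x) \<longlonglongrightarrow> l" for x l
    by (rule tendsto_cong) (use assms in \<open>auto elim: eventually_mono\<close>)
  then show ?thesis by (simp add: weak_conv_m_def weak_conv_def)
qed

lemma weak_conv_of_pointwise:
  assumes P: "prob_space P" and f: "\<And>n. f n \<in> borel_measurable P" and g: "g \<in> borel_measurable P"
    and lim: "\<And>x. x \<in> space P \<Longrightarrow> (\<lambda>n. f n x) \<longlonglongrightarrow> g x"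
  shows "weak_conv_m (\<lambda>n. distr P borel (f n)) (distr P borel g)"
proof (rule integral_bdd_continuous_conv_imp_weak_conv)
  interpret prob_space P by fact
  note f [measurable] g [measurable]
  fix h :: "real \<Rightarrow> real"
  assume cont: "\<And>x. isCont h x" and bdd: "\<And>x. \<bar>h x\<bar> \<le> 1"
  have [measurable]: "h \<in> borel_measurable borel"
    by (intro borel_measurable_continuous_onI continuous_at_imp_continuous_on ballI cont)
  have "(\<lambda>n. LINT x|P. h (f n x)) \<longlonglongrightarrow> (LINT x|P. h (g x))"
  proof (rule integral_dominated_convergence[where w="\<lambda>_. 1"])
    show "AE x in P. (\<lambda>n. h (f n x)) \<longlonglongrightarrow> h (g x)"
      by (intro AE_I2 isCont_tendsto_compose[OF cont] lim)
  qed (auto simp: bdd)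
  then show "(\<lambda>n. integral\<^sup>L (distr P borel (f n)) h) \<longlonglongrightarrow> integral\<^sup>L (distr P borel g) h"
    by (simp add: integral_distr)
next
  show "real_distribution (distr P borel (f n))" for n using P f by (rule prob_space.real_distribution_distr)
  show "real_distribution (distr P borel g)" using P g by (rule prob_space.real_distribution_distr)
qed

text \<open>Any random variable with law \<open>K\<close> may stand for the scale, in particular those of a Skorohod
representation.\<close>

lemma mixed_limit_law_distr:
  assumes \<Omega>: "prob_space \<Omega>" and D: "D \<in> borel_measurable \<Omega>"
  shows "mixed_limit_law v e (distr \<Omega> borel D) =
    distr (std_normal_distribution \<Otimes>\<^sub>M \<Omega>) borel (\<lambda>(z, \<omega>). soft_threshold (D \<omega> * e) (z + v) - v)"
proof -
  interpret \<Omega>: prob_space \<Omega> by fact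
  note D [measurable]
  interpret K: real_distribution "distr \<Omega> borel D" by (rule \<Omega>.real_distribution_distr) fact
  have "std_normal_distribution \<Otimes>\<^sub>M distr \<Omega> borel D = distr std_normal_distribution borel (\<lambda>z. z) \<Otimes>\<^sub>M distr \<Omega> borel D"
    by (simp add: distr_id2)
  also have "\<dots> = distr (std_normal_distribution \<Otimes>\<^sub>M \<Omega>) (borel \<Otimes>\<^sub>M borel) (\<lambda>(z, \<omega>). (z, D \<omega>))"
    by (rule pair_measure_distr) (auto intro: K.sigma_finite_measure_axioms)
  finally have eq: "std_normal_distribution \<Otimes>\<^sub>M distr \<Omega> borel D = distr (std_normal_distribution \<Otimes>\<^sub>M \<Omega>) (borel \<Otimes>\<^sub>M borel) (\<lambda>(z, \<omega>). (z, D \<omega>))" .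
  have m: "(\<lambda>(z, \<omega>). (z, D \<omega>)) \<in> std_normal_distribution \<Otimes>\<^sub>M \<Omega> \<rightarrow>\<^sub>M borel \<Otimes>\<^sub>M borel"
  proof -
    have "fst \<in> borel_measurable (std_normal_distribution \<Otimes>\<^sub>M \<Omega>)"
      using measurable_fst[of std_normal_distribution \<Omega>] by (simp cong: measurable_cong_sets)
    then show ?thesis unfolding case_prod_unfold by measurable
  qed
  show ?thesis unfolding mixed_limit_law_def eq using m
    by (subst distr_distr) (auto simp: comp_def case_prod_unfold)
qed

text \<open>Weak convergence depends on the laws of the scales only, so they may be replaced by a
Skorohod representation, independent of one and the same normal variable for all \<open>n\<close>. The convergence
is then pointwise, and in this form it holds without regard to the discontinuities of the limiting
distribution function.\<close>

lemma weak_conv_mixed_limit_law: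
  assumes K: "\<And>n. real_distribution (K n)" "real_distribution L" "weak_conv_m K L"
    and e: "e \<longlonglongrightarrow> e0" and \<nu>: "(\<lambda>n. ereal (\<nu> n)) \<longlonglongrightarrow> \<nu>0"
  shows "\<nu>0 = ereal v \<Longrightarrow> weak_conv_m (\<lambda>n. mixed_limit_law (\<nu> n) (e n) (K n)) (mixed_limit_law v e0 L)"
    and "\<bar>\<nu>0\<bar> = \<infinity> \<Longrightarrow> weak_conv_m (\<lambda>n. mixed_limit_law (\<nu> n) (e n) (K n)) std_normal_distribution"
proof -
  from Skorohod[OF K] obtain \<Omega> :: "real measure" and D :: "nat \<Rightarrow> real \<Rightarrow> real" and D0 where
    \<Omega>: "prob_space \<Omega>" and D: "\<And>n. D n \<in> borel_measurable \<Omega>" "\<And>n. distr \<Omega> borel (D n) = K n"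
    and D0: "D0 \<in> borel_measurable \<Omega>" "distr \<Omega> borel D0 = L"
    and lim: "\<And>x. x \<in> space \<Omega> \<Longrightarrow> (\<lambda>n. D n x) \<longlonglongrightarrow> D0 x"
    unfolding measurable_lborel1 by metis
  interpret \<Omega>: prob_space \<Omega> by fact
  interpret pair_prob_space std_normal_distribution \<Omega> by standard
  let ?P = "std_normal_distribution \<Otimes>\<^sub>M \<Omega>"
  let ?f = "\<lambda>n (z, \<omega>). soft_threshold (D n \<omega> * e n) (z + \<nu> n) - \<nu> n"
  have P: "prob_space ?P"
    by (rule prob_space_pair) (rule std_normal.prob_space_axioms \<Omega>)+
  have fst_m [measurable]: "fst \<in> borel_measurable ?P"
    using measurable_fst[of std_normal_distribution \<Omega>] by (simp cong: measurable_cong_sets)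
  have m: "(\<lambda>(z, \<omega>). soft_threshold (G \<omega> * a) (z + b) - b) \<in> borel_measurable ?P" if [measurable]: "G \<in> borel_measurable \<Omega>" for G and a b :: real
    unfolding case_prod_unfold by measurable
  have law: "mixed_limit_law (\<nu> n) (e n) (K n) = distr ?P borel (?f n)" for n
    unfolding D(2)[symmetric] by (rule mixed_limit_law_distr[OF \<Omega> D(1)])
  have De: "(\<lambda>n. D n \<omega> * e n) \<longlonglongrightarrow> D0 \<omega> * e0" if "\<omega> \<in> space \<Omega>" for \<omega>
    by (intro tendsto_mult lim that e)
  show "weak_conv_m (\<lambda>n. mixed_limit_law (\<nu> n) (e n) (K n)) (mixed_limit_law v e0 L)" if v: "\<nu>0 = ereal v"
  proof -
    have \<nu>v: "\<nu> \<longlonglongrightarrow> v" using \<nu> unfolding v by simp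
    have "weak_conv_m (\<lambda>n. distr ?P borel (?f n)) (distr ?P borel (\<lambda>(z, \<omega>). soft_threshold (D0 \<omega> * e0) (z + v) - v))"
    proof (rule weak_conv_of_pointwise[OF P])
      fix x assume "x \<in> space ?P"
      then have "snd x \<in> space \<Omega>" by (auto simp: space_pair_measure)
      then show "(\<lambda>n. ?f n x) \<longlonglongrightarrow> (case x of (z, \<omega>) \<Rightarrow> soft_threshold (D0 \<omega> * e0) (z + v) - v)"
        unfolding case_prod_unfold
        by (intro tendsto_diff tendsto_soft_threshold De tendsto_add tendsto_const \<nu>v)
    qed (rule m D D0)+
    then show ?thesis unfolding law D0(2)[symmetric] mixed_limit_law_distr[OF \<Omega> D0(1)] .
  qed
  show "weak_conv_m (\<lambda>n. mixed_limit_law (\<nu> n) (e n) (K n)) std_normal_distribution" if inf: "\<bar>\<nu>0\<bar> = \<infinity>"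
  proof -
    have at_inf: "filterlim (\<lambda>n. z + \<nu> n) at_infinity sequentially" for z
    proof -
      consider "\<nu>0 = \<infinity>" | "\<nu>0 = - \<infinity>" using inf by auto
      then have "filterlim \<nu> at_top sequentially \<or> filterlim \<nu> at_bot sequentially"
      proof cases
        case 1
        then have "filterlim \<nu> at_top sequentially"
          using \<nu> by (simp add: tendsto_PInfty filterlim_at_top_dense)
        then show ?thesis ..
      next
        case 2
        then have "filterlim \<nu> at_bot sequentially"
          using \<nu> by (simp add: tendsto_MInfty filterlim_at_bot_dense)
        then show ?thesis ..
      qed
      then have "filterlim \<nu> at_infinity sequentially"
        using filterlim_at_top_imp_at_infinity filterlim_at_bot_imp_at_infinity by blast
      then show ?thesis by (rule tendsto_add_filterlim_at_infinity[OF tendsto_const])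
    qed
    have "weak_conv_m (\<lambda>n. distr ?P borel (?f n)) (distr ?P borel fst)"
    proof (rule weak_conv_of_pointwise[OF P])
      fix x assume "x \<in> space ?P"
      then have "snd x \<in> space \<Omega>" by (auto simp: space_pair_measure)
      then have "(\<lambda>n. soft_threshold (D n (snd x) * e n) (fst x + \<nu> n) - (fst x + \<nu> n)) \<longlonglongrightarrow> 0"
        by (rule soft_threshold_at_infinity[OF De at_inf])
      then have "(\<lambda>n. (soft_threshold (D n (snd x) * e n) (fst x + \<nu> n) - (fst x + \<nu> n)) + fst x) \<longlonglongrightarrow> 0 + fst x"
        by (intro tendsto_add tendsto_const)
      then show "(\<lambda>n. ?f n x) \<longlonglongrightarrow> fst x" unfolding case_prod_unfold by (simp add: algebra_simps)
    qed (rule m D fst_m)+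
    moreover have "distr ?P borel fst = std_normal_distribution"
    proof -
      have "distr ?P borel fst = distr ?P std_normal_distribution fst" by (rule distr_cong) auto
      also have "\<dots> = std_normal_distribution"
        by (simp add: \<Omega>.distr_pair_fst)
      finally show ?thesis .
    qed
    ultimately show ?thesis unfolding law by simp
  qed
qed

section \<open>Characteristic functions determine joint laws\<close>

lemma distr_eqI_iexp:
  fixes X :: "'a \<Rightarrow> real" and Y :: "'b \<Rightarrow> real"
  assumes M: "prob_space M" and N: "prob_space N"
    and X [measurable]: "X \<in> borel_measurable M" and Y [measurable]: "Y \<in> borel_measurable N"
    and eq: "\<And>t. (CLINT \<omega>|M. iexp (t * X \<omega>)) = (CLINT \<omega>|N. iexp (t * Y \<omega>))"
  shows "distr M borel X = distr N borel Y"
proof (rule Levy_uniqueness)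
  interpret M: prob_space M by fact
  interpret N: prob_space N by fact
  show "real_distribution (distr M borel X)" "real_distribution (distr N borel Y)" by auto
  show "char (distr M borel X) = char (distr N borel Y)"
  proof
    fix t
    show "char (distr M borel X) t = char (distr N borel Y) t"
      unfolding char_def using eq[of t] by (simp add: integral_distr)
  qed
qed

text \<open>Induction on the number of variables reduces the claim to the uniqueness theorem on the line. To peel off
the variable \<open>X a\<close>, the measures are reweighted by bounded functions of \<open>X a\<close>: the characteristic
functions of the remaining variables still agree after multiplication by \<open>cos (s * X a)\<close> or \<open>sin (s * X a)\<close>,
because these are combinations of exponentials. The weights have to be nonnegative to stay within
finite measures, hence the added constant \<open>2\<close>. The induction hypothesis then identifies the
characteristic functions of \<open>X a\<close> under the measures restricted to the box of the remaining variables.\<close>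

lemma joint_law_eqI_iexp:
  fixes X :: "'i \<Rightarrow> 'a \<Rightarrow> real" and Y :: "'i \<Rightarrow> 'b \<Rightarrow> real"
  assumes "finite J" "finite_measure M" "finite_measure N"
    and "\<And>j. j \<in> J \<Longrightarrow> X j \<in> borel_measurable M" "\<And>j. j \<in> J \<Longrightarrow> Y j \<in> borel_measurable N"
    and "\<And>t. (CLINT \<omega>|M. iexp (\<Sum>j\<in>J. t j * X j \<omega>)) = (CLINT \<omega>|N. iexp (\<Sum>j\<in>J. t j * Y j \<omega>))"
    and "\<And>j. j \<in> J \<Longrightarrow> A j \<in> sets borel"
  shows "measure M {\<omega> \<in> space M. \<forall>j\<in>J. X j \<omega> \<in> A j} = measure N {\<omega> \<in> space N. \<forall>j\<in>J. Y j \<omega> \<in> A j}"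
  using assms
proof (induction J arbitrary: M N rule: finite_induct)
  case empty
  interpret M: finite_measure M by fact
  interpret N: finite_measure N by fact
  show ?case using empty.prems(5) by simp
next
  case (insert a J M N)
  interpret M: finite_measure M by fact
  interpret N: finite_measure N by fact
  have [measurable]: "X a \<in> borel_measurable M" "\<And>j. j \<in> J \<Longrightarrow> X j \<in> borel_measurable M"
    "Y a \<in> borel_measurable N" "\<And>j. j \<in> J \<Longrightarrow> Y j \<in> borel_measurable N"
    "A a \<in> sets borel" "\<And>j. j \<in> J \<Longrightarrow> A j \<in> sets borel"
    using insert.prems by auto
  note [simp] = \<open>finite J\<close>
  let ?S = "\<lambda>t \<omega>. \<Sum>j\<in>J. t j * X j \<omega>" and ?T = "\<lambda>t \<omega>. \<Sum>j\<in>J. t j * Y j \<omega>"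
  have ie: "integrable M (\<lambda>\<omega>. iexp (f \<omega>))" if [measurable]: "f \<in> borel_measurable M" for f :: "'a \<Rightarrow> real"
    by (rule M.integrable_const_bound[where B=1]) auto
  have ie': "integrable N (\<lambda>\<omega>. iexp (f \<omega>))" if [measurable]: "f \<in> borel_measurable N" for f :: "'b \<Rightarrow> real"
    by (rule N.integrable_const_bound[where B=1]) auto
  have joint: "(CLINT \<omega>|M. iexp (?S t \<omega> + s * X a \<omega>)) = (CLINT \<omega>|N. iexp (?T t \<omega> + s * Y a \<omega>))" for t s
  proof -
    have "(\<Sum>j\<in>insert a J. (t(a := s)) j * X j \<omega>) = ?S t \<omega> + s * X a \<omega>" for \<omega>
    proof -
      have "(\<Sum>j\<in>J. (t(a := s)) j * X j \<omega>) = ?S t \<omega>" using \<open>a \<notin> J\<close> by (intro sum.cong) auto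
      then show ?thesis using \<open>a \<notin> J\<close> by simp
    qed
    moreover have "(\<Sum>j\<in>insert a J. (t(a := s)) j * Y j \<omega>) = ?T t \<omega> + s * Y a \<omega>" for \<omega>
    proof -
      have "(\<Sum>j\<in>J. (t(a := s)) j * Y j \<omega>) = ?T t \<omega>" using \<open>a \<notin> J\<close> by (intro sum.cong) auto
      then show ?thesis using \<open>a \<notin> J\<close> by simp
    qed
    ultimately show ?thesis using insert.prems(5)[of "t(a := s)"] by simp
  qed
  let ?E = "{\<omega> \<in> space M. \<forall>j\<in>J. X j \<omega> \<in> A j}" and ?F = "{\<omega> \<in> space N. \<forall>j\<in>J. Y j \<omega> \<in> A j}"
  have [measurable]: "?E \<in> sets M" "?F \<in> sets N" by measurable
  \<comment> \<open>\<open>g\<close> will be a cosine or a sine; \<open>\<alpha>\<close> and \<open>\<beta>\<close> are its coefficients in terms of exponentials.\<close>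
  have weighted: "(LINT \<omega>|M. indicator ?E \<omega> * (2 + g (X a \<omega>))) = (LINT \<omega>|N. indicator ?F \<omega> * (2 + g (Y a \<omega>)))"
    if g [measurable]: "g \<in> borel_measurable borel" and b: "\<And>x. \<bar>g x\<bar> \<le> (1::real)"
      and g_eq: "\<And>x. complex_of_real (g x) = \<alpha> * iexp (s * x) + \<beta> * iexp (- s * x)" for g \<alpha> \<beta> s
  proof -
    let ?M = "density M (\<lambda>\<omega>. ennreal (2 + g (X a \<omega>)))" and ?N = "density N (\<lambda>\<omega>. ennreal (2 + g (Y a \<omega>)))"
    have nn: "0 \<le> 2 + g x" for x using b[of x] by simp
    have "2 + g x \<le> 3" for x using b[of x] by simp
    then have le': "ennreal (2 + g x) \<le> 3" for x using ennreal_leI[of "2 + g x" 3] by simp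
    have fM: "finite_measure ?M"
    proof
      have "emeasure ?M (space M) \<le> (\<integral>\<^sup>+\<omega>. 3 \<partial>M)"
        by (subst emeasure_density) (auto simp del: nn_integral_const intro!: nn_integral_mono le' split: split_indicator)
      also have "\<dots> < \<infinity>" by (simp add: M.emeasure_eq_measure ennreal_mult_less_top)
      finally show "emeasure ?M (space ?M) \<noteq> \<infinity>" by simp
    qed
    have fN: "finite_measure ?N"
    proof
      have "emeasure ?N (space N) \<le> (\<integral>\<^sup>+\<omega>. 3 \<partial>N)"
        by (subst emeasure_density) (auto simp del: nn_integral_const intro!: nn_integral_mono le' split: split_indicator)
      also have "\<dots> < \<infinity>" by (simp add: N.emeasure_eq_measure ennreal_mult_less_top)
      finally show "emeasure ?N (space ?N) \<noteq> \<infinity>" by simp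
    qed
    have split: "(2 + g x) *\<^sub>R iexp u = 2 * iexp u + \<alpha> * iexp (u + s * x) + \<beta> * iexp (u + (- s) * x)" for x u
      unfolding scaleR_conv_of_real of_real_add g_eq by (simp add: algebra_simps exp_add exp_diff exp_minus divide_inverse)
    have cf: "(CLINT \<omega>|?M. iexp (?S t \<omega>)) = (CLINT \<omega>|?N. iexp (?T t \<omega>))" for t
    proof -
      have "(CLINT \<omega>|?M. iexp (?S t \<omega>)) = (CLINT \<omega>|M. (2 + g (X a \<omega>)) *\<^sub>R iexp (?S t \<omega>))"
        by (rule integral_density) (auto simp: nn)
      also have "\<dots> = 2 * (CLINT \<omega>|M. iexp (?S t \<omega>)) + \<alpha> * (CLINT \<omega>|M. iexp (?S t \<omega> + s * X a \<omega>))
         + \<beta> * (CLINT \<omega>|M. iexp (?S t \<omega> + (- s) * X a \<omega>))"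
        unfolding split by (subst Bochner_Integration.integral_add, (intro Bochner_Integration.integrable_add integrable_mult_right ie; measurable)+)
          (subst Bochner_Integration.integral_add, (intro Bochner_Integration.integrable_add integrable_mult_right ie; measurable)+, simp)
      also have "\<dots> = 2 * (CLINT \<omega>|N. iexp (?T t \<omega>)) + \<alpha> * (CLINT \<omega>|N. iexp (?T t \<omega> + s * Y a \<omega>))
         + \<beta> * (CLINT \<omega>|N. iexp (?T t \<omega> + (- s) * Y a \<omega>))"
        unfolding joint using joint[of t 0] by simp
      also have "\<dots> = (CLINT \<omega>|N. (2 + g (Y a \<omega>)) *\<^sub>R iexp (?T t \<omega>))"
        unfolding split by (subst Bochner_Integration.integral_add, (intro Bochner_Integration.integrable_add integrable_mult_right ie'; measurable)+)
          (subst Bochner_Integration.integral_add, (intro Bochner_Integration.integrable_add integrable_mult_right ie'; measurable)+, simp)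
      also have "\<dots> = (CLINT \<omega>|?N. iexp (?T t \<omega>))"
        by (rule integral_density[symmetric]) (auto simp: nn)
      finally show ?thesis .
    qed
    have "measure ?M {\<omega> \<in> space ?M. \<forall>j\<in>J. X j \<omega> \<in> A j} = measure ?N {\<omega> \<in> space ?N. \<forall>j\<in>J. Y j \<omega> \<in> A j}"
      by (rule insert.IH[OF fM fN _ _ cf]) auto
    then have *: "measure ?M ?E = measure ?N ?F" by simp
    have "measure ?M ?E = (LINT \<omega>|?M. indicator ?E \<omega>)" by simp
    also have "\<dots> = (LINT \<omega>|M. (2 + g (X a \<omega>)) *\<^sub>R indicator ?E \<omega>)"
      by (rule integral_density) (auto simp: nn)
    finally have 1: "measure ?M ?E = (LINT \<omega>|M. indicator ?E \<omega> * (2 + g (X a \<omega>)))" by (simp add: mult.commute)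
    have "measure ?N ?F = (LINT \<omega>|?N. indicator ?F \<omega>)" by simp
    also have "\<dots> = (LINT \<omega>|N. (2 + g (Y a \<omega>)) *\<^sub>R indicator ?F \<omega>)"
      by (rule integral_density) (auto simp: nn)
    finally have 2: "measure ?N ?F = (LINT \<omega>|N. indicator ?F \<omega> * (2 + g (Y a \<omega>)))" by (simp add: mult.commute)
    from * 1 2 show ?thesis by simp
  qed
  have "(LINT \<omega>|M. indicator ?E \<omega> * (2 + 0)) = (LINT \<omega>|N. indicator ?F \<omega> * (2 + 0 :: real))"
    by (rule weighted[where g="\<lambda>_. 0" and \<alpha>=0 and \<beta>=0]) auto
  then have EF: "measure M ?E = measure N ?F" by simp
  have unweighted: "(LINT \<omega>|M. indicator ?E \<omega> * g (X a \<omega>)) = (LINT \<omega>|N. indicator ?F \<omega> * g (Y a \<omega>))"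
    if g [measurable]: "g \<in> borel_measurable borel" and b: "\<And>x. \<bar>g x\<bar> \<le> (1::real)"
      and g_eq: "\<And>x. complex_of_real (g x) = \<alpha> * iexp (s * x) + \<beta> * iexp (- s * x)" for g \<alpha> \<beta> s
  proof -
    have 1: "integrable M (\<lambda>\<omega>. indicator ?E \<omega> * g (X a \<omega>))"
      by (rule M.integrable_const_bound[where B=1]) (auto simp: b split: split_indicator)
    have 2: "integrable N (\<lambda>\<omega>. indicator ?F \<omega> * g (Y a \<omega>))"
      by (rule N.integrable_const_bound[where B=1]) (auto simp: b split: split_indicator)
    have i1: "integrable M (\<lambda>\<omega>. indicator ?E \<omega> * (2::real))"
      by (rule M.integrable_const_bound[where B=2]) (auto split: split_indicator)
    have i2: "integrable N (\<lambda>\<omega>. indicator ?F \<omega> * (2::real))"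
      by (rule N.integrable_const_bound[where B=2]) (auto split: split_indicator)
    have "(LINT \<omega>|M. indicator ?E \<omega> * 2 + indicator ?E \<omega> * g (X a \<omega>)) = (LINT \<omega>|N. indicator ?F \<omega> * 2 + indicator ?F \<omega> * g (Y a \<omega>))"
      using weighted[OF that] by (simp add: algebra_simps)
    then show ?thesis unfolding Bochner_Integration.integral_add[OF i1 1] Bochner_Integration.integral_add[OF i2 2]
      using EF by simp
  qed
  have cs: "(CLINT \<omega>|M. indicator ?E \<omega> *\<^sub>R iexp (s * X a \<omega>)) = (CLINT \<omega>|N. indicator ?F \<omega> *\<^sub>R iexp (s * Y a \<omega>))" for s
  proof (rule complex_eqI)
    have c: "complex_of_real (cos (s * x)) = 1/2 * iexp (s * x) + 1/2 * iexp (- s * x)" for x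
      unfolding cos_of_real[symmetric] cos_exp_eq by (simp add: field_simps)
    have d: "complex_of_real (sin (s * x)) = 1/(2*\<i>) * iexp (s * x) + (- 1/(2*\<i>)) * iexp (- s * x)" for x
      unfolding sin_of_real[symmetric] sin_exp_eq by (simp add: field_simps)
    have i1: "integrable M (\<lambda>\<omega>. indicator ?E \<omega> *\<^sub>R iexp (s * X a \<omega>))"
      by (rule M.integrable_const_bound[where B=1]) (auto split: split_indicator)
    have i2: "integrable N (\<lambda>\<omega>. indicator ?F \<omega> *\<^sub>R iexp (s * Y a \<omega>))"
      by (rule N.integrable_const_bound[where B=1]) (auto split: split_indicator)
    have "(LINT \<omega>|M. indicator ?E \<omega> * cos (s * X a \<omega>)) = (LINT \<omega>|N. indicator ?F \<omega> * cos (s * Y a \<omega>))"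
      by (rule unweighted[where g="\<lambda>x. cos (s * x)", OF _ _ c]) auto
    then show "Re (CLINT \<omega>|M. indicator ?E \<omega> *\<^sub>R iexp (s * X a \<omega>)) = Re (CLINT \<omega>|N. indicator ?F \<omega> *\<^sub>R iexp (s * Y a \<omega>))"
      using i1 i2 by (simp add: integral_Re[symmetric] Re_exp)
    have "(LINT \<omega>|M. indicator ?E \<omega> * sin (s * X a \<omega>)) = (LINT \<omega>|N. indicator ?F \<omega> * sin (s * Y a \<omega>))"
      by (rule unweighted[where g="\<lambda>x. sin (s * x)", OF _ _ d]) auto
    then show "Im (CLINT \<omega>|M. indicator ?E \<omega> *\<^sub>R iexp (s * X a \<omega>)) = Im (CLINT \<omega>|N. indicator ?F \<omega> *\<^sub>R iexp (s * Y a \<omega>))"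
      using i1 i2 by (simp add: integral_Im[symmetric] Im_exp)
  qed
  have sets_eq: "{\<omega> \<in> space M. \<forall>j\<in>insert a J. X j \<omega> \<in> A j} = ?E \<inter> {\<omega> \<in> space M. X a \<omega> \<in> A a}"
     "{\<omega> \<in> space N. \<forall>j\<in>insert a J. Y j \<omega> \<in> A j} = ?F \<inter> {\<omega> \<in> space N. Y a \<omega> \<in> A a}" by auto
  show ?case
  proof (cases "measure M ?E = 0")
    case True
    then have "measure M (?E \<inter> {\<omega> \<in> space M. X a \<omega> \<in> A a}) = 0" "measure N (?F \<inter> {\<omega> \<in> space N. Y a \<omega> \<in> A a}) = 0"
      using M.finite_measure_mono[of "?E \<inter> {\<omega> \<in> space M. X a \<omega> \<in> A a}" ?E]
        N.finite_measure_mono[of "?F \<inter> {\<omega> \<in> space N. Y a \<omega> \<in> A a}" ?F] EF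
      by (auto simp: measure_le_0_iff)
    then show ?thesis unfolding sets_eq by simp
  next
    case False
    \<comment> \<open>The uniqueness theorem on the line is about probability measures, so both measures are
      conditioned on their boxes, which have the same mass \<open>p\<close>.\<close>
    define p where "p = measure M ?E"
    have p: "0 < p" using False by (simp add: p_def zero_less_measure_iff)
    have pN: "p = measure N ?F" using EF by (simp add: p_def)
    let ?M = "density M (\<lambda>\<omega>. ennreal (indicator ?E \<omega> / p))" and ?N = "density N (\<lambda>\<omega>. ennreal (indicator ?F \<omega> / p))"
    have emM: "emeasure ?M B = ennreal (measure M (?E \<inter> B) / p)" if [measurable]: "B \<in> sets M" for B
    proof -
      have "emeasure ?M B = (\<integral>\<^sup>+\<omega>. ennreal (1/p) * indicator (?E \<inter> B) \<omega> \<partial>M)"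
        by (subst emeasure_density) (auto intro!: nn_integral_cong split: split_indicator)
      also have "\<dots> = ennreal (1/p) * ennreal (measure M (?E \<inter> B))"
        by (subst nn_integral_cmult_indicator) (auto simp: M.emeasure_eq_measure)
      finally show ?thesis using p by (simp add: ennreal_mult'[symmetric])
    qed
    have emN: "emeasure ?N B = ennreal (measure N (?F \<inter> B) / p)" if [measurable]: "B \<in> sets N" for B
    proof -
      have "emeasure ?N B = (\<integral>\<^sup>+\<omega>. ennreal (1/p) * indicator (?F \<inter> B) \<omega> \<partial>N)"
        by (subst emeasure_density) (auto intro!: nn_integral_cong split: split_indicator)
      also have "\<dots> = ennreal (1/p) * ennreal (measure N (?F \<inter> B))"
        by (subst nn_integral_cmult_indicator) (auto simp: N.emeasure_eq_measure)
      finally show ?thesis using p by (simp add: ennreal_mult'[symmetric])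
    qed
    have EI: "?E \<inter> space M = ?E" "?F \<inter> space N = ?F" by auto
    have "distr ?M borel (X a) = distr ?N borel (Y a)"
    proof (rule distr_eqI_iexp)
      show "prob_space ?M" using p by (intro prob_spaceI) (simp add: emM EI p_def[symmetric])
      show "prob_space ?N" using p by (intro prob_spaceI) (simp add: emN EI pN[symmetric])
      fix t
      have "(CLINT \<omega>|?M. iexp (t * X a \<omega>)) = (CLINT \<omega>|M. (indicator ?E \<omega> / p) *\<^sub>R iexp (t * X a \<omega>))"
        using p by (intro integral_density) auto
      also have "\<dots> = (1 / p) *\<^sub>R (CLINT \<omega>|M. indicator ?E \<omega> *\<^sub>R iexp (t * X a \<omega>))"
        by (subst Bochner_Integration.integral_scaleR_right[symmetric]) (simp add: divide_inverse mult.commute)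
      also have "\<dots> = (1 / p) *\<^sub>R (CLINT \<omega>|N. indicator ?F \<omega> *\<^sub>R iexp (t * Y a \<omega>))"
        by (simp only: cs)
      also have "\<dots> = (CLINT \<omega>|N. (indicator ?F \<omega> / p) *\<^sub>R iexp (t * Y a \<omega>))"
        by (subst Bochner_Integration.integral_scaleR_right[symmetric]) (simp add: divide_inverse mult.commute)
      also have "\<dots> = (CLINT \<omega>|?N. iexp (t * Y a \<omega>))"
        using p by (intro integral_density[symmetric]) auto
      finally show "(CLINT \<omega>|?M. iexp (t * X a \<omega>)) = (CLINT \<omega>|?N. iexp (t * Y a \<omega>))" .
    qed auto
    then have "emeasure (distr ?M borel (X a)) (A a) = emeasure (distr ?N borel (Y a)) (A a)" by simp
    then have "ennreal (measure M (?E \<inter> {\<omega> \<in> space M. X a \<omega> \<in> A a}) / p) = ennreal (measure N (?F \<inter> {\<omega> \<in> space N. Y a \<omega> \<in> A a}) / p)"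
      by (simp add: emeasure_distr emM emN vimage_def Int_def conj_commute Collect_conj_eq[symmetric])
    then have "measure M (?E \<inter> {\<omega> \<in> space M. X a \<omega> \<in> A a}) = measure N (?F \<inter> {\<omega> \<in> space N. Y a \<omega> \<in> A a})"
      using p by (subst (asm) ennreal_inj) auto
    then show ?thesis unfolding sets_eq .
  qed
qed

section \<open>Orthonormal bases adapted to a matrix\<close>

lemma sum_mult_delta:
  fixes f :: "nat \<Rightarrow> real"
  assumes "a < n" shows "(\<Sum>j<n. f j * (if a = j then 1 else 0)) = f a"
proof -
  have "(\<Sum>j<n. f j * (if a = j then 1 else 0)) = (\<Sum>j<n. if a = j then f j else 0)"
    by (intro sum.cong) auto
  then show ?thesis using assms by simp
qed

text \<open>This is the QR decomposition by Householder reflections. If the rows of \<open>w\<close> triangularise the first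
\<open>k\<close> vectors and \<open>y\<close> holds the coordinates of the next one, reflect the coordinate space in the
hyperplane orthogonal to \<open>v\<close>, the part of \<open>y\<close> from index \<open>k\<close> on, minus its norm times the \<open>k\<close>-th unit
vector. The reflection leaves the first \<open>k\<close> coordinates alone and moves the rest of \<open>y\<close> to the \<open>k\<close>-th axis.\<close>

lemma orthonormal_triangular_basis:
  fixes x :: "nat \<Rightarrow> nat \<Rightarrow> real"
  assumes "k \<le> n"
  shows "\<exists>w :: nat \<Rightarrow> nat \<Rightarrow> real.
    (\<forall>a<n. \<forall>b<n. (\<Sum>j<n. w a j * w b j) = (if a = b then 1 else 0)) \<and>
    (\<forall>l<k. \<forall>a. l < a \<longrightarrow> a < n \<longrightarrow> (\<Sum>j<n. w a j * x l j) = 0)"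
  using assms
proof (induction k)
  case 0
  have "(\<Sum>j<n. (if j = a then 1 else 0) * (if j = b then 1 else 0)) = (if a = b then 1 else 0 :: real)" if "a < n" for a b
    using that by (simp add: if_distrib[where f="\<lambda>t. t * _"] sum.delta cong: if_cong)
  then show ?case by (intro exI[of _ "\<lambda>a j. if j = a then 1 else 0"]) simp
next
  case (Suc k)
  from Suc.IH[OF Suc_leD[OF Suc.prems]] obtain w :: "nat \<Rightarrow> nat \<Rightarrow> real" where
    "(\<forall>a<n. \<forall>b<n. (\<Sum>j<n. w a j * w b j) = (if a = b then 1 else 0)) \<and>
     (\<forall>l<k. \<forall>a. l < a \<longrightarrow> a < n \<longrightarrow> (\<Sum>j<n. w a j * x l j) = 0)" ..
  then have w: "\<And>a b. a < n \<Longrightarrow> b < n \<Longrightarrow> (\<Sum>j<n. w a j * w b j) = (if a = b then 1 else 0)"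
    and w0: "\<And>l a. l < k \<Longrightarrow> l < a \<Longrightarrow> a < n \<Longrightarrow> (\<Sum>j<n. w a j * x l j) = 0"
    by blast+
  have kn: "k < n" using Suc.prems by simp
  define y where "y a = (\<Sum>j<n. w a j * x k j)" for a
  define T where "T = (\<Sum>a\<in>{k..<n}. (y a)\<^sup>2)"
  define s where "s = sqrt T"
  have s2: "s\<^sup>2 = T" by (simp add: s_def T_def sum_nonneg)
  define v where "v a = (if a < k then 0 else if a = k then y a - s else y a)" for a
  define V where "V = (\<Sum>a<n. (v a)\<^sup>2)"
  \<comment> \<open>For \<open>v = 0\<close> this is \<open>2 / 0 = 0\<close>, and the reflection becomes the identity.\<close>
  define \<beta> where "\<beta> = 2 / V"
  define q where "q j = (\<Sum>b<n. v b * w b j)" for j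
  define w' where "w' a j = w a j - \<beta> * v a * q j" for a j
  have wq: "(\<Sum>j<n. w a j * q j) = v a" if "a < n" for a
  proof -
    have "(\<Sum>j<n. w a j * q j) = (\<Sum>j<n. \<Sum>b<n. v b * (w a j * w b j))"
      by (simp add: q_def sum_distrib_left mult.left_commute)
    also have "\<dots> = (\<Sum>b<n. \<Sum>j<n. v b * (w a j * w b j))" by (rule sum.swap)
    also have "\<dots> = (\<Sum>b<n. v b * (if a = b then 1 else 0))"
      by (intro sum.cong refl) (simp add: w[OF that] sum_distrib_left[symmetric])
    also have "\<dots> = v a" using that by (rule sum_mult_delta)
    finally show ?thesis .
  qed
  have qx: "(\<Sum>j<n. q j * f j) = (\<Sum>b<n. v b * (\<Sum>j<n. w b j * f j))" for f :: "nat \<Rightarrow> real"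
    unfolding q_def sum_distrib_right sum_distrib_left by (subst sum.swap) (simp add: mult.assoc)
  have qq: "(\<Sum>j<n. q j * q j) = V"
    unfolding qx V_def by (intro sum.cong refl) (simp add: wq power2_eq_square)
  have w'f: "(\<Sum>j<n. w' a j * f j) = (\<Sum>j<n. w a j * f j) - \<beta> * v a * (\<Sum>j<n. q j * f j)" for a and f :: "nat \<Rightarrow> real"
    unfolding w'_def by (simp add: left_diff_distrib sum_subtractf sum_distrib_left mult.assoc)
  have ortho: "(\<Sum>j<n. w' a j * w' b j) = (if a = b then 1 else 0)" if "a < n" "b < n" for a b
  proof -
    have f: "(\<Sum>j<n. f j * w' b j) = (\<Sum>j<n. f j * w b j) - \<beta> * v b * (\<Sum>j<n. f j * q j)" for f :: "nat \<Rightarrow> real"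
      using w'f[of b f] by (simp add: mult.commute)
    have "(\<Sum>j<n. q j * w a j) = v a" "(\<Sum>j<n. q j * w b j) = v b"
      using wq[OF that(1)] wq[OF that(2)] by (simp_all add: mult.commute)
    then have "(\<Sum>j<n. w' a j * w' b j) = (if a = b then 1 else 0) + v a * v b * (\<beta>\<^sup>2 * V - 2 * \<beta>)"
      unfolding w'f f by (simp add: w wq that qq algebra_simps power2_eq_square)
    moreover have "\<beta>\<^sup>2 * V - 2 * \<beta> = 0" unfolding \<beta>_def by (simp add: power2_eq_square)
    ultimately show ?thesis by simp
  qed
  have split: "(\<Sum>a<n. f a) = (\<Sum>a<k. f a) + f k + (\<Sum>a\<in>{Suc k..<n}. f a)" for f :: "nat \<Rightarrow> real"
  proof -
    have "(\<Sum>a<n. f a) = (\<Sum>a<k. f a) + (\<Sum>a\<in>{k..<n}. f a)"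
      using kn by (simp add: lessThan_atLeast0 sum.atLeastLessThan_concat)
    then show ?thesis using sum.atLeast_Suc_lessThan[OF kn, of f] by simp
  qed
  have Tk: "T = (y k)\<^sup>2 + (\<Sum>a\<in>{Suc k..<n}. (y a)\<^sup>2)"
    unfolding T_def by (rule sum.atLeast_Suc_lessThan[OF kn])
  have V: "V = 2 * (T - s * y k)"
  proof -
    have "V = (y k - s)\<^sup>2 + (\<Sum>a\<in>{Suc k..<n}. (y a)\<^sup>2)"
      unfolding V_def split by (simp add: v_def)
    then show ?thesis using s2 Tk by (simp add: power2_diff)
  qed
  have vy: "(\<Sum>b<n. v b * y b) = T - s * y k"
  proof -
    have "(\<Sum>b<n. v b * y b) = (y k - s) * y k + (\<Sum>a\<in>{Suc k..<n}. (y a)\<^sup>2)"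
      unfolding split by (simp add: v_def power2_eq_square)
    then show ?thesis using Tk by (simp add: power2_eq_square algebra_simps)
  qed
  have tri: "(\<Sum>j<n. w' a j * x l j) = 0" if l: "l < Suc k" and a: "l < a" "a < n" for l a
  proof (cases "l = k")
    case True
    have "(\<Sum>j<n. w' a j * x l j) = y a - \<beta> * v a * (T - s * y k)"
      unfolding w'f qx True by (simp add: y_def[symmetric] vy)
    also have "\<dots> = 0"
    proof (cases "V = 0")
      case V0: True
      then have "v a = 0" using a unfolding V_def by (subst (asm) sum_nonneg_eq_0_iff) auto
      then show ?thesis using a True by (simp add: v_def)
    next
      case False
      then have "\<beta> * (T - s * y k) = 1" unfolding \<beta>_def using V by simp
      then have "\<beta> * v a * (T - s * y k) = v a" by (simp add: mult.commute mult.left_commute)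
      then show ?thesis using a True by (simp add: v_def)
    qed
    finally show ?thesis .
  next
    case False
    then have l: "l < k" using l by simp
    have "(\<Sum>b<n. v b * (\<Sum>j<n. w b j * x l j)) = 0"
      by (rule sum.neutral) (use w0 l in \<open>auto simp: v_def\<close>)
    then show ?thesis unfolding w'f qx using w0[OF l a] by simp
  qed
  from ortho tri show ?case by (intro exI[of _ w'] conjI allI impI) blast+
qed

text \<open>Orthonormal rows of a square matrix give orthonormal columns.\<close>

lemma parseval_rows:
  fixes w :: "nat \<Rightarrow> nat \<Rightarrow> real"
  assumes w: "\<And>a b. a < n \<Longrightarrow> b < n \<Longrightarrow> (\<Sum>j<n. w a j * w b j) = (if a = b then 1 else 0)"
  shows "(\<Sum>a<n. (\<Sum>j<n. w a j * f j) * (\<Sum>j<n. w a j * g j)) = (\<Sum>j<n. f j * g j)"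
proof -
  define W where "W = mat n n (\<lambda>(a, j). w a j)"
  have W: "W \<in> carrier_mat n n" by (simp add: W_def)
  have "W * transpose_mat W = 1\<^sub>m n"
    by (rule eq_matI) (auto simp: W_def scalar_prod_def w lessThan_atLeast0[symmetric])
  then have "transpose_mat W * W = 1\<^sub>m n"
    using W by (intro mat_mult_left_right_inverse[of W]) auto
  then have cols: "(\<Sum>a<n. w a i * w a j) = (if i = j then 1 else 0)" if "i < n" "j < n" for i j
  proof -
    have "(transpose_mat W * W) $$ (i, j) = (\<Sum>a<n. w a i * w a j)"
      using that by (simp add: W_def scalar_prod_def lessThan_atLeast0[symmetric])
    then show ?thesis using that \<open>transpose_mat W * W = 1\<^sub>m n\<close> by simp
  qed
  have "(\<Sum>a<n. (\<Sum>j<n. w a j * f j) * (\<Sum>j<n. w a j * g j)) = (\<Sum>a<n. \<Sum>i<n. \<Sum>j<n. f i * g j * (w a i * w a j))"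
    by (simp add: sum_product algebra_simps)
  also have "\<dots> = (\<Sum>i<n. \<Sum>a<n. \<Sum>j<n. f i * g j * (w a i * w a j))" by (rule sum.swap)
  also have "\<dots> = (\<Sum>i<n. \<Sum>j<n. \<Sum>a<n. f i * g j * (w a i * w a j))"
    by (intro sum.cong refl sum.swap)
  also have "\<dots> = (\<Sum>i<n. \<Sum>j<n. f i * g j * (if i = j then 1 else 0))"
    by (intro sum.cong refl) (simp add: cols sum_distrib_left[symmetric])
  also have "\<dots> = (\<Sum>i<n. f i * g i)" by (intro sum.cong refl sum_mult_delta) simp
  finally show ?thesis .
qed

section \<open>Least squares\<close>

lemma scalar_prod_lessThan: "scalar_prod v w = (\<Sum>j<dim_vec w. vec_index v j * vec_index w j)"
  by (simp add: scalar_prod_def lessThan_atLeast0)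

text \<open>The rank counts a maximal independent subset of the set of columns, so full rank first has to rule out
repeated columns before it yields independence.\<close>

lemma full_rank_mult_eq_0:
  fixes X :: "real mat"
  assumes X: "X \<in> carrier_mat n k" and rank: "vec_space.rank n X = k"
    and v: "v \<in> carrier_vec k" and Xv: "X *\<^sub>v v = 0\<^sub>v n"
  shows "v = 0\<^sub>v k"
proof (rule ccontr)
  assume nz: "v \<noteq> 0\<^sub>v k"
  interpret vec_space "TYPE(real)" n .
  obtain S where S: "maximal S (\<lambda>T. T \<subseteq> set (cols X) \<and> lin_indpt T)"
    using maximal_exists[of "\<lambda>T. T \<subseteq> set (cols X) \<and> lin_indpt T" "card (set (cols X))" "{}"]
    by (meson List.finite_set card_mono empty_iff empty_subsetI finite_lin_indpt2 rev_finite_subset)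
  then have "card S \<le> card (set (cols X))" by (simp add: card_mono maximal_def)
  moreover have "card S = k" using rank_card_indpt[OF X S] rank by simp
  moreover have "card (set (cols X)) \<le> length (cols X)" by (rule card_length)
  ultimately have d: "distinct (cols X)" using X by (intro card_distinct) simp
  show False using full_rank_lin_indpt[OF X rank d] lin_depI[OF X v nz Xv d] by simp
qed

lemma inverse_mat_of_invertible:
  assumes A: "A \<in> carrier_mat k k" and det: "det A \<noteq> 0"
  shows "inverse_mat A \<in> carrier_mat k k" "A * inverse_mat A = 1\<^sub>m k" "inverse_mat A * A = 1\<^sub>m k"
proof -
  have "A \<in> Units (ring_mat TYPE(real) k ())" by (rule det_non_zero_imp_unit[OF A det])
  then obtain B where "mat_inverse A = Some B" using mat_inverse(1)[OF A, where b="()"] by (cases "mat_inverse A") auto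
  from mat_inverse(2)[OF A this] this show "inverse_mat A \<in> carrier_mat k k" "A * inverse_mat A = 1\<^sub>m k" "inverse_mat A * A = 1\<^sub>m k"
    by (auto simp: inverse_mat_def)
qed

locale full_rank_design =
  fixes X :: "real mat" and n k :: nat
  assumes X: "X \<in> carrier_mat n k" and rank: "vec_space.rank n X = k" and k_less_n: "k < n"
begin

abbreviation gram :: "real mat" where "gram \<equiv> transpose_mat X * X"
abbreviation gram_inv :: "real mat" where "gram_inv \<equiv> inverse_mat gram"

lemma gram_carrier: "gram \<in> carrier_mat k k" using X by simp

lemma det_gram: "det gram \<noteq> 0"
proof
  assume "det gram = 0"
  then obtain v where v: "v \<in> carrier_vec k" "v \<noteq> 0\<^sub>v k" "gram *\<^sub>v v = 0\<^sub>v k"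
    using det_0_iff_vec_prod_zero[OF gram_carrier] by auto
  have Xv: "X *\<^sub>v v \<in> carrier_vec n" using X by (intro carrier_vecI) simp
  have "transpose_mat X *\<^sub>v (X *\<^sub>v v) = 0\<^sub>v k" using v(3) X by (simp add: assoc_mult_mat_vec[OF _ X v(1)])
  then have "scalar_prod (X *\<^sub>v v) (X *\<^sub>v v) = 0"
    using transpose_vec_mult_scalar[OF X v(1) Xv] v(1) by simp
  then have "(\<Sum>j<n. (vec_index (X *\<^sub>v v) j)\<^sup>2) = 0"
    using X by (simp add: scalar_prod_lessThan power2_eq_square)
  then have "\<forall>j<n. vec_index (X *\<^sub>v v) j = 0" by (subst (asm) sum_nonneg_eq_0_iff) auto
  then have "X *\<^sub>v v = 0\<^sub>v n" using X by (intro eq_vecI) auto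
  with full_rank_mult_eq_0[OF X rank v(1)] v(2) show False by simp
qed

lemmas gram_inv = inverse_mat_of_invertible[OF gram_carrier det_gram]

text \<open>The factor \<open>n\<close> passes through the inverse; in terms of the weights below, \<open>xi X i\<close> is \<open>sqrt n\<close> times their norm.\<close>

lemma xi_eq: "xi X i = sqrt (real n * gram_inv $$ (i, i))" if i: "i < k"
proof -
  let ?G = "(1 / real n) \<cdot>\<^sub>m gram"
  have n: "real n \<noteq> 0" using k_less_n by simp
  have G: "?G \<in> carrier_mat k k" using gram_carrier by simp
  have "det ?G \<noteq> 0" using det_gram n gram_carrier by (simp add: det_smult)
  note inv = inverse_mat_of_invertible[OF G this]
  have Bn: "real n \<cdot>\<^sub>m gram_inv \<in> carrier_mat k k" using gram_inv by simp
  have 1: "(real n \<cdot>\<^sub>m gram_inv) * ?G = 1\<^sub>m k"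
    unfolding mult_smult_assoc_mat[OF gram_inv(1) G] mult_smult_distrib[OF gram_inv(1) gram_carrier] gram_inv(3)
    using n by (intro eq_matI) auto
  have "inverse_mat ?G = ((real n \<cdot>\<^sub>m gram_inv) * ?G) * inverse_mat ?G" using 1 inv by simp
  also have "\<dots> = (real n \<cdot>\<^sub>m gram_inv) * (?G * inverse_mat ?G)" by (rule assoc_mult_mat[OF Bn G inv(1)])
  also have "\<dots> = real n \<cdot>\<^sub>m gram_inv" unfolding inv(2) by (rule right_mult_one_mat[OF Bn])
  finally have "inverse_mat ?G = real n \<cdot>\<^sub>m gram_inv" .
  then show ?thesis unfolding xi_def using X i gram_inv(1) by simp
qed

text \<open>The vector \<open>c\<close> with \<open>c \<bullet> u\<close> the estimation error of the \<open>i\<close>-th least squares component.\<close>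

definition LS_weights :: "nat \<Rightarrow> real Matrix.vec" where
  "LS_weights i = X *\<^sub>v row gram_inv i"

lemma LS_weights_carrier: "LS_weights i \<in> carrier_vec n"
  using X unfolding LS_weights_def by (intro carrier_vecI) simp

lemma row_gram_inv_carrier: "row gram_inv i \<in> carrier_vec k"
  using gram_inv(1) by (intro carrier_vecI) simp

text \<open>With \<open>G\<close> the Gram matrix and \<open>b\<close> the \<open>i\<close>-th row of its inverse, \<open>G b\<close> is the \<open>i\<close>-th unit vector by
the symmetry of \<open>G\<close>, and the squared norm of \<open>X b\<close> is \<open>b \<bullet> G b\<close>.\<close>

lemma LS_weights_norm: "(\<Sum>j<n. (vec_index (LS_weights i) j)\<^sup>2) = gram_inv $$ (i, i)" if i: "i < k"
proof -
  note r = row_gram_inv_carrier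
  have "gram * transpose_mat gram_inv = transpose_mat (gram_inv * gram)"
    using X gram_inv(1) gram_carrier by (simp add: transpose_mult[OF gram_inv(1) gram_carrier] transpose_mult[of "transpose_mat X" k n X k])
  then have one: "gram * transpose_mat gram_inv = 1\<^sub>m k" using gram_inv by simp
  have "A *\<^sub>v row B i = col (A * transpose_mat B) i" if "A \<in> carrier_mat k k" "B \<in> carrier_mat k k" for A B :: "real mat"
    using that i by (intro eq_vecI) auto
  from this[OF gram_carrier gram_inv(1)]
  have "gram *\<^sub>v row gram_inv i = col (gram * transpose_mat gram_inv) i" .
  also have "\<dots> = unit_vec k i" using i one by simp
  finally have g: "gram *\<^sub>v row gram_inv i = unit_vec k i" .
  have "(\<Sum>j<n. (vec_index (LS_weights i) j)\<^sup>2) = scalar_prod (LS_weights i) (LS_weights i)"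
    using LS_weights_carrier[of i] by (simp add: scalar_prod_lessThan power2_eq_square)
  also have "\<dots> = scalar_prod (transpose_mat X *\<^sub>v LS_weights i) (row gram_inv i)"
    using transpose_vec_mult_scalar[OF X r LS_weights_carrier, of i i] by (simp add: LS_weights_def)
  also have "transpose_mat X *\<^sub>v LS_weights i = unit_vec k i"
    unfolding LS_weights_def using g X by (simp add: assoc_mult_mat_vec[OF _ X r])
  also have "scalar_prod (unit_vec k i) (row gram_inv i) = gram_inv $$ (i, i)"
    using i r[of i] gram_inv(1) by (simp add: scalar_prod_left_unit)
  finally show ?thesis .
qed

lemma gram_inv_diag_pos: "0 < gram_inv $$ (i, i)" if i: "i < k"
proof (rule ccontr)
  assume "\<not> 0 < gram_inv $$ (i, i)"
  then have "(\<Sum>j<n. (vec_index (LS_weights i) j)\<^sup>2) \<le> 0" using LS_weights_norm[OF i] by simp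
  then have "(\<Sum>j<n. (vec_index (LS_weights i) j)\<^sup>2) = 0" by (simp add: sum_nonneg antisym)
  then have "\<forall>j<n. vec_index (LS_weights i) j = 0" by (subst (asm) sum_nonneg_eq_0_iff) auto
  then have "LS_weights i = 0\<^sub>v n" using LS_weights_carrier[of i] by (intro eq_vecI) auto
  then have "row gram_inv i = 0\<^sub>v k"
    unfolding LS_weights_def by (rule full_rank_mult_eq_0[OF X rank row_gram_inv_carrier])
  then have "row (gram_inv * gram) i = 0\<^sub>v k"
    using i gram_inv(1) gram_carrier by (intro eq_vecI) auto
  then have "vec_index (row (1\<^sub>m k :: real mat) i) i = 0" using gram_inv(3) i by simp
  then show False using i by simp
qed

lemma theta_LS_eq:
  assumes \<theta>: "\<theta> \<in> carrier_vec k" and u: "u \<in> carrier_vec n"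
  shows "theta_LS X (X *\<^sub>v \<theta> + u) = \<theta> + gram_inv *\<^sub>v (transpose_mat X *\<^sub>v u)"
proof -
  have XT: "transpose_mat X \<in> carrier_mat k n" using X by simp
  have X\<theta>: "X *\<^sub>v \<theta> \<in> carrier_vec n" using X by (intro carrier_vecI) simp
  have "transpose_mat X *\<^sub>v (X *\<^sub>v \<theta> + u) = gram *\<^sub>v \<theta> + transpose_mat X *\<^sub>v u"
    using X \<theta> by (simp add: mult_add_distrib_mat_vec[OF XT X\<theta> u] assoc_mult_mat_vec[OF XT X \<theta>])
  then have "theta_LS X (X *\<^sub>v \<theta> + u) = gram_inv *\<^sub>v (gram *\<^sub>v \<theta> + transpose_mat X *\<^sub>v u)"
    by (simp add: theta_LS_def)
  also have "\<dots> = gram_inv *\<^sub>v (gram *\<^sub>v \<theta>) + gram_inv *\<^sub>v (transpose_mat X *\<^sub>v u)"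
    by (rule mult_add_distrib_mat_vec[OF gram_inv(1)]) (use X \<theta> u in auto)
  also have "gram_inv *\<^sub>v (gram *\<^sub>v \<theta>) = \<theta>"
    using \<theta> by (simp add: assoc_mult_mat_vec[OF gram_inv(1) gram_carrier \<theta>, symmetric] gram_inv)
  finally show ?thesis .
qed

lemma theta_LS_component:
  assumes \<theta>: "\<theta> \<in> carrier_vec k" and u: "u \<in> carrier_vec n" and i: "i < k"
  shows "vec_index (theta_LS X (X *\<^sub>v \<theta> + u)) i =
    vec_index \<theta> i + (\<Sum>j<n. vec_index (LS_weights i) j * vec_index u j)"
proof -
  have XTu: "transpose_mat X *\<^sub>v u \<in> carrier_vec k" using X by (intro carrier_vecI) simp
  have "vec_index (gram_inv *\<^sub>v (transpose_mat X *\<^sub>v u)) i = scalar_prod (row gram_inv i) (transpose_mat X *\<^sub>v u)"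
    using i gram_inv(1) by simp
  also have "\<dots> = scalar_prod (transpose_mat X *\<^sub>v u) (row gram_inv i)"
    by (rule comm_scalar_prod[OF row_gram_inv_carrier XTu])
  also have "\<dots> = scalar_prod u (LS_weights i)"
    unfolding LS_weights_def by (rule transpose_vec_mult_scalar[OF X row_gram_inv_carrier u])
  also have "\<dots> = (\<Sum>j<n. vec_index (LS_weights i) j * vec_index u j)"
    using LS_weights_carrier[of i] by (simp add: scalar_prod_lessThan mult.commute)
  finally show ?thesis unfolding theta_LS_eq[OF \<theta> u] using i gram_inv(1) \<theta> by simp
qed

lemma row_times_X:
  assumes v: "v \<in> carrier_vec k"
  shows "(\<Sum>j<n. f j * vec_index (X *\<^sub>v v) j) = (\<Sum>l<k. vec_index v l * (\<Sum>j<n. f j * X $$ (j, l)))"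
proof -
  have "(\<Sum>j<n. f j * vec_index (X *\<^sub>v v) j) = (\<Sum>j<n. \<Sum>l<k. vec_index v l * (f j * X $$ (j, l)))"
    using X v by (intro sum.cong refl) (simp add: scalar_prod_lessThan sum_distrib_left mult_ac)
  also have "\<dots> = (\<Sum>l<k. \<Sum>j<n. vec_index v l * (f j * X $$ (j, l)))" by (rule sum.swap)
  finally show ?thesis by (simp add: sum_distrib_left)
qed

text \<open>The rows of a triangularising orthonormal basis with index at least \<open>k\<close> are orthogonal to all columns of \<open>X\<close>, hence also to
the least squares weights, and they see only the error part of the observations. The other rows do not see
the residual: its coordinates along them solve a linear system with the transpose of the triangular
factor, which is invertible by the full rank of \<open>X\<close>. So Parseval's identity leaves exactly \<open>n - k\<close> squares in
the residual sum of squares.\<close>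

lemma residual_basis:
  "\<exists>w :: nat \<Rightarrow> nat \<Rightarrow> real.
    (\<forall>a<n - k. \<forall>b<n - k. (\<Sum>j<n. w a j * w b j) = (if a = b then 1 else 0)) \<and>
    (\<forall>a<n - k. \<forall>i<k. (\<Sum>j<n. w a j * vec_index (LS_weights i) j) = 0) \<and>
    (\<forall>\<theta>\<in>carrier_vec k. \<forall>u\<in>carrier_vec n.
      sigma_hat X (X *\<^sub>v \<theta> + u) = sqrt (\<Sum>a<n - k. (\<Sum>j<n. w a j * vec_index u j)\<^sup>2) / sqrt (real (n - k)))"
proof -
  from orthonormal_triangular_basis[OF less_imp_le[OF k_less_n], of "\<lambda>l j. X $$ (j, l)"]
  obtain w :: "nat \<Rightarrow> nat \<Rightarrow> real" where
    "(\<forall>a<n. \<forall>b<n. (\<Sum>j<n. w a j * w b j) = (if a = b then 1 else 0)) \<and>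
     (\<forall>l<k. \<forall>a. l < a \<longrightarrow> a < n \<longrightarrow> (\<Sum>j<n. w a j * X $$ (j, l)) = 0)" ..
  then have w: "\<And>a b. a < n \<Longrightarrow> b < n \<Longrightarrow> (\<Sum>j<n. w a j * w b j) = (if a = b then 1 else 0)"
    and w0: "\<And>l a. l < k \<Longrightarrow> l < a \<Longrightarrow> a < n \<Longrightarrow> (\<Sum>j<n. w a j * X $$ (j, l)) = 0"
    by blast+
  have perp: "(\<Sum>j<n. w a j * vec_index (X *\<^sub>v v) j) = 0" if v: "v \<in> carrier_vec k" and a: "k \<le> a" "a < n" for v a
    unfolding row_times_X[OF v] using w0 a by (intro sum.neutral) auto
  define R where "R = mat k k (\<lambda>(a, l). \<Sum>j<n. w a j * X $$ (j, l))"
  have R: "R \<in> carrier_mat k k" by (simp add: R_def)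
  have Rv: "vec_index (R *\<^sub>v v) a = (\<Sum>j<n. w a j * vec_index (X *\<^sub>v v) j)" if v: "v \<in> carrier_vec k" and a: "a < k" for v a
    unfolding row_times_X[OF v] using a v by (simp add: R_def scalar_prod_lessThan mult.commute)
  have "det R \<noteq> 0"
  proof
    assume "det R = 0"
    then obtain v where v: "v \<in> carrier_vec k" "v \<noteq> 0\<^sub>v k" "R *\<^sub>v v = 0\<^sub>v k"
      using det_0_iff_vec_prod_zero[OF R] by auto
    have z: "(\<Sum>j<n. w a j * vec_index (X *\<^sub>v v) j) = 0" if "a < n" for a
      using Rv[OF v(1), of a] perp[OF v(1), of a] that v(3) by (cases "a < k") auto
    have "(\<Sum>j<n. vec_index (X *\<^sub>v v) j * vec_index (X *\<^sub>v v) j) = 0"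
      using parseval_rows[OF w, of "vec_index (X *\<^sub>v v)" "vec_index (X *\<^sub>v v)"] by (simp add: z)
    then have "\<forall>j<n. vec_index (X *\<^sub>v v) j = 0" by (subst (asm) sum_nonneg_eq_0_iff) auto
    then have "X *\<^sub>v v = 0\<^sub>v n" using X by (intro eq_vecI) auto
    with full_rank_mult_eq_0[OF X rank v(1)] v(2) show False by simp
  qed
  then have detRT: "det (transpose_mat R) \<noteq> 0" using det_transpose[OF R] by simp
  have inside: "(\<Sum>j<n. w a j * vec_index r j) = 0"
    if r: "r \<in> carrier_vec n" and Xr: "transpose_mat X *\<^sub>v r = 0\<^sub>v k" and a: "a < k" for r a
  proof -
    define \<rho> where "\<rho> = vec k (\<lambda>a. \<Sum>j<n. w a j * vec_index r j)"
    have "transpose_mat R *\<^sub>v \<rho> = 0\<^sub>v k"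
    proof (rule eq_vecI)
      show "dim_vec (transpose_mat R *\<^sub>v \<rho>) = dim_vec (0\<^sub>v k)" using R by simp
      fix l assume "l < dim_vec (0\<^sub>v k :: real Matrix.vec)"
      then have l: "l < k" by simp
      have "vec_index (transpose_mat R *\<^sub>v \<rho>) l = (\<Sum>a<k. (\<Sum>j<n. w a j * X $$ (j, l)) * (\<Sum>j<n. w a j * vec_index r j))"
        using l by (simp add: R_def \<rho>_def scalar_prod_lessThan)
      also have "\<dots> = (\<Sum>a<n. (\<Sum>j<n. w a j * X $$ (j, l)) * (\<Sum>j<n. w a j * vec_index r j))"
        using k_less_n w0 l by (intro sum.mono_neutral_left) auto
      also have "\<dots> = (\<Sum>j<n. X $$ (j, l) * vec_index r j)" by (rule parseval_rows[OF w])
      also have "\<dots> = vec_index (transpose_mat X *\<^sub>v r) l"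
        using X r l by (simp add: scalar_prod_lessThan)
      finally show "vec_index (transpose_mat R *\<^sub>v \<rho>) l = vec_index (0\<^sub>v k) l" using Xr by simp
    qed
    moreover have "\<rho> \<in> carrier_vec k" by (simp add: \<rho>_def)
    ultimately have "\<rho> = 0\<^sub>v k" using detRT det_0_iff_vec_prod_zero[of "transpose_mat R" k] R by auto
    then have "vec_index \<rho> a = 0" using a by simp
    then show ?thesis using a by (simp add: \<rho>_def)
  qed
  show ?thesis
  proof (intro exI[of _ "\<lambda>a. w (k + a)"] conjI allI impI ballI)
    show "(\<Sum>j<n. w (k + a) j * w (k + b) j) = (if a = b then 1 else 0)" if "a < n - k" "b < n - k" for a b
      using that w[of "k + a" "k + b"] by auto
    show "(\<Sum>j<n. w (k + a) j * vec_index (LS_weights i) j) = 0" if "a < n - k" "i < k" for a i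
      unfolding LS_weights_def using that by (intro perp row_gram_inv_carrier) auto
    fix \<theta> u :: "real Matrix.vec" assume \<theta>: "\<theta> \<in> carrier_vec k" and u: "u \<in> carrier_vec n"
    define g where "g = gram_inv *\<^sub>v (transpose_mat X *\<^sub>v u)"
    have XTu: "transpose_mat X *\<^sub>v u \<in> carrier_vec k" using X by (intro carrier_vecI) simp
    have g: "g \<in> carrier_vec k" using gram_inv(1) unfolding g_def by (intro carrier_vecI) simp
    have Xg: "X *\<^sub>v g \<in> carrier_vec n" and X\<theta>: "X *\<^sub>v \<theta> \<in> carrier_vec n" using X by (intro carrier_vecI; simp)+
    define r where "r = X *\<^sub>v \<theta> + u - X *\<^sub>v theta_LS X (X *\<^sub>v \<theta> + u)"
    have r_eq: "r = u - X *\<^sub>v g"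
      unfolding r_def theta_LS_eq[OF \<theta> u] g_def[symmetric] mult_add_distrib_mat_vec[OF X \<theta> g]
      using u Xg X\<theta> by (intro eq_vecI) (auto simp: carrier_matD[OF X])
    have r: "r \<in> carrier_vec n" using u Xg by (simp add: r_eq)
    have XT: "transpose_mat X \<in> carrier_mat k n" using X by simp
    have "transpose_mat X *\<^sub>v (X *\<^sub>v g) = gram *\<^sub>v g"
      by (rule assoc_mult_mat_vec[OF XT X g, symmetric])
    also have "\<dots> = (gram * gram_inv) *\<^sub>v (transpose_mat X *\<^sub>v u)"
      unfolding g_def by (rule assoc_mult_mat_vec[OF gram_carrier gram_inv(1) XTu, symmetric])
    also have "\<dots> = transpose_mat X *\<^sub>v u" unfolding gram_inv(2) using XTu by simp
    finally have "transpose_mat X *\<^sub>v (X *\<^sub>v g) = transpose_mat X *\<^sub>v u" .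
    then have Xr: "transpose_mat X *\<^sub>v r = 0\<^sub>v k"
      unfolding r_eq mult_minus_distrib_mat_vec[OF XT u Xg] using XTu by simp
    have outside: "(\<Sum>j<n. w a j * vec_index r j) = (\<Sum>j<n. w a j * vec_index u j)" if "k \<le> a" "a < n" for a
    proof -
      have "(\<Sum>j<n. w a j * vec_index r j) = (\<Sum>j<n. w a j * vec_index u j) - (\<Sum>j<n. w a j * vec_index (X *\<^sub>v g) j)"
        unfolding sum_subtractf[symmetric]
        by (intro sum.cong refl) (use u Xg in \<open>simp add: r_eq right_diff_distrib carrier_matD[OF X]\<close>)
      then show ?thesis using perp[OF g that] by simp
    qed
    have "scalar_prod r r = (\<Sum>j<n. vec_index r j * vec_index r j)" using r by (simp add: scalar_prod_lessThan)
    also have "\<dots> = (\<Sum>a<n. (\<Sum>j<n. w a j * vec_index r j) * (\<Sum>j<n. w a j * vec_index r j))"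
      by (rule parseval_rows[OF w, symmetric])
    also have "\<dots> = (\<Sum>a\<in>{k..<n}. (\<Sum>j<n. w a j * vec_index u j)\<^sup>2)"
      using inside[OF r Xr] outside
      by (intro sum.mono_neutral_cong_right) (auto simp: power2_eq_square not_le)
    also have "\<dots> = (\<Sum>a<n - k. (\<Sum>j<n. w (k + a) j * vec_index u j)\<^sup>2)"
      by (rule sum.reindex_bij_witness[where i="\<lambda>a. k + a" and j="\<lambda>a. a - k"]) auto
    finally have "scalar_prod r r = (\<Sum>a<n - k. (\<Sum>j<n. w (k + a) j * vec_index u j)\<^sup>2)" .
    then show "sigma_hat X (X *\<^sub>v \<theta> + u) = sqrt (\<Sum>a<n - k. (\<Sum>j<n. w (k + a) j * vec_index u j)\<^sup>2) / sqrt (real (n - k))"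
      unfolding sigma_hat_def Let_def r_def[symmetric] using X k_less_n by (simp add: real_sqrt_divide of_nat_diff)
  qed
qed

end

section \<open>Gaussian vectors in an orthonormal basis\<close>

lemma iexp_std_normal_product:
  "(CLINT z|std_normal_product n. iexp (\<Sum>j<n. t j * z j)) = complex_of_real (exp (- (\<Sum>j<n. (t j)\<^sup>2) / 2))"
proof -
  have int: "integrable std_normal_distribution (\<lambda>x. iexp (t j * x))" for j
    by (rule std_normal.integrable_const_bound[where B=1]) auto
  have "(CLINT z|std_normal_product n. iexp (\<Sum>j<n. t j * z j)) =
      (CLINT z|std_normal_product n. (\<Prod>j<n. iexp (t j * z j)))"
    by (simp add: exp_sum sum_distrib_left)
  also have "\<dots> = (\<Prod>j<n. CLINT x|std_normal_distribution. iexp (t j * x))"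
    by (rule std_normal_product.product_integral_prod) (rule finite_lessThan, rule int)
  also have "\<dots> = (\<Prod>j<n. complex_of_real (exp (- (t j)\<^sup>2 / 2)))"
    using char_std_normal_distribution by (intro prod.cong refl) (simp add: char_def fun_eq_iff)
  also have "\<dots> = complex_of_real (exp (\<Sum>j<n. - (t j)\<^sup>2 / 2))"
    by (simp add: exp_sum)
  also have "(\<Sum>j<n. - (t j)\<^sup>2 / 2) = - (\<Sum>j<n. (t j)\<^sup>2) / 2"
    by (simp add: sum_negf sum_divide_distrib)
  finally show ?thesis .
qed

text \<open>A linear form \<open>\<Sum> t a * y a\<close> in the new coordinates is a linear form in the old ones whose coefficient
vector has the same norm as \<open>t\<close>, and the characteristic function depends on this norm only.\<close>

lemma std_normal_product_orthonormal:
  fixes w :: "nat \<Rightarrow> nat \<Rightarrow> real"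
  assumes orth: "\<And>a b. a < m \<Longrightarrow> b < m \<Longrightarrow> (\<Sum>j<n. w a j * w b j) = (if a = b then 1 else 0)"
  shows "distr (std_normal_product n) (\<Pi>\<^sub>M a\<in>{..<m}. borel) (\<lambda>z. \<lambda>a\<in>{..<m}. \<Sum>j<n. w a j * z j) = std_normal_product m"
proof (rule std_normal_product.PiM_eqI)
  let ?L = "\<lambda>a z. \<Sum>j<n. w a j * z j"
  have [measurable]: "?L a \<in> borel_measurable (std_normal_product n)" for a
    by (intro borel_measurable_sum borel_measurable_times borel_measurable_const measurable_std_normal_component) auto
  interpret P: prob_space "std_normal_product n" by (rule prob_space_std_normal_product)
  interpret Q: prob_space "std_normal_product m" by (rule prob_space_std_normal_product)
  show "sets (distr (std_normal_product n) (\<Pi>\<^sub>M a\<in>{..<m}. borel) (\<lambda>z. \<lambda>a\<in>{..<m}. ?L a z)) = sets (std_normal_product m)"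
    unfolding sets_distr by (rule sets_PiM_cong) auto
  fix A :: "nat \<Rightarrow> real set" assume "\<And>a. a \<in> {..<m} \<Longrightarrow> A a \<in> sets std_normal_distribution"
  then have A: "\<And>a. a \<in> {..<m} \<Longrightarrow> A a \<in> sets borel" by simp
  have PiE_sets: "Pi\<^sub>E {..<m} A \<in> sets (\<Pi>\<^sub>M a\<in>{..<m}. borel)"
    by (rule sets_PiM_I_finite) (use A in auto)
  have mL: "(\<lambda>z. \<lambda>a\<in>{..<m}. ?L a z) \<in> std_normal_product n \<rightarrow>\<^sub>M (\<Pi>\<^sub>M a\<in>{..<m}. borel)"
    by (rule measurable_restrict) measurable
  have cf: "(CLINT z|std_normal_product n. iexp (\<Sum>a<m. t a * ?L a z)) = (CLINT z|std_normal_product m. iexp (\<Sum>a<m. t a * z a))" for t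
  proof -
    let ?c = "\<lambda>j. \<Sum>a<m. t a * w a j"
    have "(\<Sum>a<m. t a * ?L a z) = (\<Sum>j<n. ?c j * z j)" for z
      unfolding sum_distrib_left sum_distrib_right by (subst sum.swap) (simp add: mult.assoc)
    moreover have "(\<Sum>j<n. (?c j)\<^sup>2) = (\<Sum>a<m. (t a)\<^sup>2)"
    proof -
      have "(\<Sum>j<n. (?c j)\<^sup>2) = (\<Sum>j<n. \<Sum>a<m. \<Sum>b<m. t a * t b * (w a j * w b j))"
        by (simp add: power2_eq_square sum_product mult_ac)
      also have "\<dots> = (\<Sum>a<m. \<Sum>j<n. \<Sum>b<m. t a * t b * (w a j * w b j))" by (rule sum.swap)
      also have "\<dots> = (\<Sum>a<m. \<Sum>b<m. \<Sum>j<n. t a * t b * (w a j * w b j))"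
        by (intro sum.cong refl sum.swap)
      also have "\<dots> = (\<Sum>a<m. \<Sum>b<m. t a * t b * (if a = b then 1 else 0))"
        by (intro sum.cong refl) (simp add: orth sum_distrib_left[symmetric])
      also have "\<dots> = (\<Sum>a<m. t a * t a)" by (intro sum.cong refl sum_mult_delta) simp
      finally show ?thesis by (simp add: power2_eq_square)
    qed
    ultimately show ?thesis by (simp only: iexp_std_normal_product)
  qed
  have "emeasure (distr (std_normal_product n) (\<Pi>\<^sub>M a\<in>{..<m}. borel) (\<lambda>z. \<lambda>a\<in>{..<m}. ?L a z)) (Pi\<^sub>E {..<m} A)
    = emeasure (std_normal_product n) {z \<in> space (std_normal_product n). \<forall>a\<in>{..<m}. ?L a z \<in> A a}"
  proof -
    have "(\<lambda>z. \<lambda>a\<in>{..<m}. ?L a z) -` Pi\<^sub>E {..<m} A \<inter> space (std_normal_product n)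
      = {z \<in> space (std_normal_product n). \<forall>a\<in>{..<m}. ?L a z \<in> A a}"
      by (simp add: PiE_iff vimage_def Int_def conj_commute)
    then show ?thesis unfolding emeasure_distr[OF mL PiE_sets] by simp
  qed
  also have "\<dots> = ennreal (P.prob {z \<in> space (std_normal_product n). \<forall>a\<in>{..<m}. ?L a z \<in> A a})"
    by (rule P.emeasure_eq_measure)
  also have "P.prob {z \<in> space (std_normal_product n). \<forall>a\<in>{..<m}. ?L a z \<in> A a} =
      Q.prob {z \<in> space (std_normal_product m). \<forall>a\<in>{..<m}. z a \<in> A a}"
  proof (rule joint_law_eqI_iexp[where X="?L" and Y="\<lambda>a z. z a" and A=A])
    show "finite_measure (std_normal_product n)" "finite_measure (std_normal_product m)"
      by (rule P.finite_measure_axioms Q.finite_measure_axioms)+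
    show "(\<lambda>z. z a) \<in> borel_measurable (std_normal_product m)" if "a \<in> {..<m}" for a
      using that by (rule measurable_std_normal_component)
    show "?L a \<in> borel_measurable (std_normal_product n)" for a
      by measurable
    show "A a \<in> sets borel" if "a \<in> {..<m}" for a
      using that by (rule A)
    show "(CLINT z|std_normal_product n. iexp (\<Sum>a<m. t a * ?L a z)) = (CLINT z|std_normal_product m. iexp (\<Sum>a<m. t a * z a))" for t
      by (rule cf)
  qed simp
  also have "{z \<in> space (std_normal_product m). \<forall>a\<in>{..<m}. z a \<in> A a} = Pi\<^sub>E {..<m} A"
    by (simp add: space_PiM PiE_def Pi_def set_eq_iff conj_commute Ball_def)
  also have "ennreal (Q.prob (Pi\<^sub>E {..<m} A)) = emeasure (std_normal_product m) (Pi\<^sub>E {..<m} A)"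
    by (rule Q.emeasure_eq_measure[symmetric])
  also have "\<dots> = (\<Prod>a<m. emeasure std_normal_distribution (A a))"
    by (rule std_normal_product.emeasure_PiM) (use A in auto)
  finally show "emeasure (distr (std_normal_product n) (\<Pi>\<^sub>M a\<in>{..<m}. borel) (\<lambda>z. \<lambda>a\<in>{..<m}. ?L a z)) (Pi\<^sub>E {..<m} A)
    = (\<Prod>a<m. emeasure std_normal_distribution (A a))" .
qed simp

text \<open>The last coordinate will be the standardised least squares error, the others the coordinates of the
residual.\<close>

lemma std_normal_product_last_and_scale:
  "distr (std_normal_product (Suc m)) (borel \<Otimes>\<^sub>M borel) (\<lambda>z. (z m, sqrt (\<Sum>a<m. (z a)\<^sup>2) / sqrt (real m)))
    = std_normal_distribution \<Otimes>\<^sub>M chi_law m"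
proof -
  let ?D = "\<lambda>z :: nat \<Rightarrow> real. sqrt (\<Sum>a<m. (z a)\<^sup>2) / sqrt (real m)"
  interpret P: prob_space "std_normal_product m" by (rule prob_space_std_normal_product)
  interpret C: real_distribution "chi_law m" by (rule real_distribution_chi_law)
  have eq: "std_normal_product (Suc m) = (\<Pi>\<^sub>M j\<in>insert m {..<m}. std_normal_distribution)"
    by (simp add: lessThan_Suc)
  have D: "?D \<in> borel_measurable (std_normal_product m)" by measurable
  have D': "?D \<in> borel_measurable (std_normal_product (Suc m))"
    by (intro borel_measurable_divide borel_measurable_const borel_measurable_sqrt borel_measurable_sum borel_measurable_power measurable_std_normal_component) auto
  have c: "(\<lambda>z. z m) \<in> borel_measurable (std_normal_product (Suc m))"
    by (rule measurable_std_normal_component) simp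
  have G: "(\<lambda>z. (z m, ?D z)) \<in> std_normal_product (Suc m) \<rightarrow>\<^sub>M borel \<Otimes>\<^sub>M borel"
    using c D' by (rule measurable_Pair)
  have "distr (std_normal_product (Suc m)) (borel \<Otimes>\<^sub>M borel) (\<lambda>z. (z m, ?D z)) =
    distr (distr (std_normal_distribution \<Otimes>\<^sub>M std_normal_product m) (std_normal_product (Suc m)) (\<lambda>(x, z). z(m := x)))
      (borel \<Otimes>\<^sub>M borel) (\<lambda>z. (z m, ?D z))"
    unfolding eq by (subst distr_pair_PiM_eq_PiM) (auto intro: std_normal.prob_space_axioms)
  also have "\<dots> = distr (std_normal_distribution \<Otimes>\<^sub>M std_normal_product m) (borel \<Otimes>\<^sub>M borel) ((\<lambda>z. (z m, ?D z)) \<circ> (\<lambda>(x, z). z(m := x)))"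
  proof (rule distr_distr[OF G])
    show "(\<lambda>(x, z). z(m := x)) \<in> std_normal_distribution \<Otimes>\<^sub>M std_normal_product m \<rightarrow>\<^sub>M std_normal_product (Suc m)"
      unfolding eq by measurable
  qed
  also have "(\<lambda>z. (z m, ?D z)) \<circ> (\<lambda>(x, z). z(m := x)) = (\<lambda>(x, z). (x, ?D z))"
    by (auto simp: fun_eq_iff)
  also have "distr (std_normal_distribution \<Otimes>\<^sub>M std_normal_product m) (borel \<Otimes>\<^sub>M borel) (\<lambda>(x, z). (x, ?D z))
    = distr std_normal_distribution borel (\<lambda>x. x) \<Otimes>\<^sub>M distr (std_normal_product m) borel ?D"
  proof (rule pair_measure_distr[symmetric])
    show "sigma_finite_measure (distr (std_normal_product m) borel ?D)"
      unfolding chi_law_eq[symmetric] by (rule C.sigma_finite_measure_axioms)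
  qed (use D in auto)
  finally show ?thesis by (simp add: chi_law_eq distr_id2)
qed

section \<open>The exact law of the scaled estimation error\<close>

lemma soft_threshold_scale:
  "s \<noteq> 0 \<Longrightarrow> soft_threshold (s * c) (s * y) = s * soft_threshold c y"
  by (simp add: soft_threshold_def power_mult_distrib)

lemma theta_AS_eq_soft_threshold:
  "theta_AS X i \<eta> y = soft_threshold (sigma_hat X y * xi X i * \<eta>) (vec_index (theta_LS X y) i)"
  by (simp add: theta_AS_def soft_threshold_def power_mult_distrib Let_def)

lemma (in gaussian_regression) distr_standardized_errors:
  "distr M (\<Pi>\<^sub>M j\<in>{..<n}. borel) (\<lambda>\<omega>. \<lambda>j\<in>{..<n}. vec_index (u \<omega>) j / \<sigma>) = std_normal_product n"
proof -
  have ne: "{..<n} \<noteq> {}" using k_pos k_less_n by (auto simp: lessThan_empty_iff)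
  have rv: "random_variable borel (\<lambda>\<omega>. vec_index (u \<omega>) j / \<sigma>)" if "j \<in> {..<n}" for j
    using distributed_measurable[OF u_normal[of j]] that by simp
  have "indep_vars (\<lambda>_. borel) (\<lambda>j \<omega>. vec_index (u \<omega>) j / \<sigma>) {..<n}"
    by (rule indep_vars_compose2[OF u_indep]) simp
  then have "distr M (\<Pi>\<^sub>M j\<in>{..<n}. borel) (\<lambda>\<omega>. \<lambda>j\<in>{..<n}. vec_index (u \<omega>) j / \<sigma>) =
      (\<Pi>\<^sub>M j\<in>{..<n}. distr M borel (\<lambda>\<omega>. vec_index (u \<omega>) j / \<sigma>))"
    using indep_vars_iff_distr_eq_PiM'[OF ne, where X="\<lambda>j \<omega>. vec_index (u \<omega>) j / \<sigma>" and M'="\<lambda>_. borel"] rv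
    by blast
  also have "\<dots> = std_normal_product n"
  proof (rule PiM_cong[OF refl])
    fix j assume "j \<in> {..<n}"
    then have "distributed M lborel (\<lambda>\<omega>. (vec_index (u \<omega>) j - 0) / \<sigma>) std_normal_density"
      by (intro normal_standard_normal_convert[OF \<sigma>_pos, THEN iffD1] u_normal) simp
    then have "distr M lborel (\<lambda>\<omega>. vec_index (u \<omega>) j / \<sigma>) = std_normal_distribution"
      by (simp add: distributed_def)
    moreover have "distr M lborel (\<lambda>\<omega>. vec_index (u \<omega>) j / \<sigma>) = distr M borel (\<lambda>\<omega>. vec_index (u \<omega>) j / \<sigma>)"
      by (rule distr_cong) auto
    ultimately show "distr M borel (\<lambda>\<omega>. vec_index (u \<omega>) j / \<sigma>) = std_normal_distribution" by simp
  qed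
  finally show ?thesis .
qed

text \<open>The standardised least squares weights together with the \<open>n - k\<close> residual directions form an
orthonormal system, so the estimation error and the residual scale are built from disjoint sets of
independent standard normal coordinates. The
remaining work is bookkeeping of scales: every quantity of the model is \<open>\<sigma> * c\<close> times its standardised
counterpart, with \<open>c\<close> the norm of the weights.\<close>

theorem (in gaussian_regression) distr_scaled_estimation_error:
  assumes i: "i < k"
  shows "distr M borel (\<lambda>\<omega>. 1 / \<sigma> * (sqrt (real n) / xi X i) * (theta_AS X i \<eta> (Y \<omega>) - vec_index \<theta> i)) =
    mixed_limit_law (sqrt (real n) * vec_index \<theta> i / (\<sigma> * xi X i)) (sqrt (real n) * \<eta>) (chi_law (n - k))"
proof -
  interpret full_rank_design X n k
    using X_carrier X_rank k_less_n by unfold_locales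
  define m where "m = n - k"
  define c where "c = sqrt (gram_inv $$ (i, i))"
  have c: "0 < c" "c\<^sup>2 = gram_inv $$ (i, i)" using gram_inv_diag_pos[OF i] by (auto simp: c_def)
  have n: "0 < real n" using k_less_n by simp
  have xi: "xi X i = sqrt (real n) * c" by (simp add: xi_eq[OF i] c_def real_sqrt_mult)
  define \<nu> where "\<nu> = vec_index \<theta> i / (\<sigma> * c)"
  have \<nu>: "sqrt (real n) * vec_index \<theta> i / (\<sigma> * xi X i) = \<nu>" using n by (simp add: xi \<nu>_def)
  from residual_basis obtain w :: "nat \<Rightarrow> nat \<Rightarrow> real" where w':
    "(\<forall>a<m. \<forall>b<m. (\<Sum>j<n. w a j * w b j) = (if a = b then 1 else 0)) \<and>
    (\<forall>a<m. \<forall>i<k. (\<Sum>j<n. w a j * vec_index (LS_weights i) j) = 0) \<and>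
    (\<forall>\<theta>\<in>carrier_vec k. \<forall>u\<in>carrier_vec n.
      sigma_hat X (X *\<^sub>v \<theta> + u) = sqrt (\<Sum>a<m. (\<Sum>j<n. w a j * vec_index u j)\<^sup>2) / sqrt (real m))"
    unfolding m_def ..
  have w: "(\<Sum>j<n. w a j * w b j) = (if a = b then 1 else 0)" if "a < m" "b < m" for a b
    using w' that by blast
  have wLS: "(\<Sum>j<n. w a j * vec_index (LS_weights i) j) = 0" if "a < m" for a
    using w' that i by blast
  have sig: "sigma_hat X (X *\<^sub>v \<theta> + v) = sqrt (\<Sum>a<m. (\<Sum>j<n. w a j * vec_index v j)\<^sup>2) / sqrt (real m)"
    if "v \<in> carrier_vec n" for v
    using w' that \<theta>_carrier by blast
  \<comment> \<open>Rows \<open>0\<close> to \<open>m - 1\<close> span the residual space, row \<open>m\<close> is the direction of the least squares error.\<close>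
  define W where "W a j = (if a < m then w a j else vec_index (LS_weights i) j / c)" for a j
  have W: "(\<Sum>j<n. W a j * W b j) = (if a = b then 1 else 0)" if "a < Suc m" "b < Suc m" for a b
  proof -
    have "(\<Sum>j<n. vec_index (LS_weights i) j / c * (vec_index (LS_weights i) j / c)) = (\<Sum>j<n. (vec_index (LS_weights i) j)\<^sup>2) / c\<^sup>2"
      by (simp add: sum_divide_distrib power2_eq_square)
    also have "\<dots> = 1" using c gram_inv_diag_pos[OF i] LS_weights_norm[OF i] by simp
    finally have 1: "(\<Sum>j<n. vec_index (LS_weights i) j / c * (vec_index (LS_weights i) j / c)) = 1" .
    have 2: "(\<Sum>j<n. w a j * (vec_index (LS_weights i) j / c)) = 0" if "a < m" for a
      using wLS[OF that] by (simp add: sum_divide_distrib[symmetric])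
    have 3: "(\<Sum>j<n. vec_index (LS_weights i) j / c * w a j) = 0" if "a < m" for a
      using 2[OF that] by (simp add: mult.commute)
    have "a < m \<or> a = m" "b < m \<or> b = m" using that by auto
    then consider "a < m" "b < m" | "a < m" "b = m" | "a = m" "b < m" | "a = m" "b = m" by blast
    then show ?thesis
    proof cases
      case 1
      then show ?thesis unfolding W_def using w by simp
    next
      case b: 2
      then show ?thesis unfolding W_def using 2[of a] by simp
    next
      case a: 3
      then show ?thesis unfolding W_def using 3[of b] by simp
    next
      case m: 4
      then show ?thesis unfolding W_def using 1 by simp
    qed
  qed
  let ?z = "\<lambda>\<omega>. \<lambda>j\<in>{..<n}. vec_index (u \<omega>) j / \<sigma>"
  let ?L = "\<lambda>z. \<lambda>a\<in>{..<Suc m}. \<Sum>j<n. W a j * z j"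
  let ?G = "\<lambda>z :: nat \<Rightarrow> real. (z m, sqrt (\<Sum>a<m. (z a)\<^sup>2) / sqrt (real m))"
  let ?h = "\<lambda>(z, d). soft_threshold (d * (sqrt (real n) * \<eta>)) (z + \<nu>) - \<nu>"
  have pointwise: "1 / \<sigma> * (sqrt (real n) / xi X i) * (theta_AS X i \<eta> (Y \<omega>) - vec_index \<theta> i) = ?h (?G (?L (?z \<omega>)))"
    if \<omega>: "\<omega> \<in> space M" for \<omega>
  proof -
    define s where "s = \<sigma> * c"
    have s: "0 < s" using \<sigma>_pos c by (simp add: s_def)
    define Z where "Z = (\<Sum>j<n. vec_index (LS_weights i) j / c * (vec_index (u \<omega>) j / \<sigma>))"
    define D where "D = sqrt (\<Sum>a<m. (\<Sum>j<n. w a j * (vec_index (u \<omega>) j / \<sigma>))\<^sup>2) / sqrt (real m)"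
    have u: "u \<omega> \<in> carrier_vec n" using u_carrier \<omega> .
    have "?G (?L (?z \<omega>)) = (Z, D)" by (simp add: Z_def D_def W_def)
    have sZ: "(\<Sum>j<n. vec_index (LS_weights i) j * vec_index (u \<omega>) j) = s * Z"
      using c \<sigma>_pos by (simp add: Z_def s_def sum_distrib_left)
    have sig_u: "sigma_hat X (Y \<omega>) = \<sigma> * D"
    proof -
      have eq: "(\<Sum>j<n. w a j * (vec_index (u \<omega>) j / \<sigma>)) = (\<Sum>j<n. w a j * vec_index (u \<omega>) j) / \<sigma>" for a
        by (simp add: sum_divide_distrib)
      have "D = sqrt ((\<Sum>a<m. (\<Sum>j<n. w a j * vec_index (u \<omega>) j)\<^sup>2) / \<sigma>\<^sup>2) / sqrt (real m)"
        unfolding D_def eq power_divide sum_divide_distrib[symmetric] ..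
      then show ?thesis using \<sigma>_pos sig[OF u] by (simp add: Y_eq[OF \<omega>] real_sqrt_divide)
    qed
    have LS: "vec_index (theta_LS X (Y \<omega>)) i = s * (Z + \<nu>)"
      unfolding Y_eq[OF \<omega>] theta_LS_component[OF \<theta>_carrier u i] sZ
      using s by (simp add: \<nu>_def s_def[symmetric] distrib_left)
    have "sigma_hat X (Y \<omega>) * xi X i * \<eta> = s * (D * (sqrt (real n) * \<eta>))"
      unfolding sig_u xi s_def by simp
    then have "theta_AS X i \<eta> (Y \<omega>) = s * soft_threshold (D * (sqrt (real n) * \<eta>)) (Z + \<nu>)"
      unfolding theta_AS_eq_soft_threshold LS using s by (simp only: soft_threshold_scale)
    moreover have "vec_index \<theta> i = s * \<nu>" using s by (simp add: \<nu>_def s_def[symmetric])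
    moreover have "1 / \<sigma> * (sqrt (real n) / xi X i) = 1 / s" using n by (simp add: xi s_def)
    ultimately show ?thesis using s unfolding \<open>?G (?L (?z \<omega>)) = (Z, D)\<close>
      by (simp add: right_diff_distrib[symmetric])
  qed
  have rv: "random_variable borel (\<lambda>\<omega>. vec_index (u \<omega>) j / \<sigma>)" if "j \<in> {..<n}" for j
    using distributed_measurable[OF u_normal[of j]] that by simp
  have mz: "?z \<in> M \<rightarrow>\<^sub>M (\<Pi>\<^sub>M j\<in>{..<n}. borel)" by (rule measurable_restrict) (rule rv)
  have mL: "?L \<in> (\<Pi>\<^sub>M j\<in>{..<n}. borel) \<rightarrow>\<^sub>M (\<Pi>\<^sub>M a\<in>{..<Suc m}. borel)"
    by (intro measurable_restrict borel_measurable_sum borel_measurable_times borel_measurable_const measurable_component_singleton) auto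
  have mG: "?G \<in> (\<Pi>\<^sub>M a\<in>{..<Suc m}. borel) \<rightarrow>\<^sub>M borel \<Otimes>\<^sub>M borel"
    by (intro measurable_Pair borel_measurable_divide borel_measurable_const borel_measurable_sqrt borel_measurable_sum
      borel_measurable_power measurable_component_singleton) auto
  have mh: "?h \<in> borel_measurable (borel \<Otimes>\<^sub>M borel)" by measurable
  have "std_normal_distribution \<Otimes>\<^sub>M chi_law m = distr (std_normal_product (Suc m)) (borel \<Otimes>\<^sub>M borel) ?G"
    by (rule std_normal_product_last_and_scale[symmetric])
  also have "std_normal_product (Suc m) = distr (std_normal_product n) (\<Pi>\<^sub>M a\<in>{..<Suc m}. borel) ?L"
    by (rule std_normal_product_orthonormal[symmetric]) (rule W)
  also have "std_normal_product n = distr M (\<Pi>\<^sub>M j\<in>{..<n}. borel) ?z"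
    by (rule distr_standardized_errors[symmetric])
  also have "distr (distr M (\<Pi>\<^sub>M j\<in>{..<n}. borel) ?z) (\<Pi>\<^sub>M a\<in>{..<Suc m}. borel) ?L = distr M (\<Pi>\<^sub>M a\<in>{..<Suc m}. borel) (?L \<circ> ?z)"
    by (rule distr_distr[OF mL mz])
  also have "distr \<dots> (borel \<Otimes>\<^sub>M borel) ?G = distr M (borel \<Otimes>\<^sub>M borel) (?G \<circ> (?L \<circ> ?z))"
    by (rule distr_distr[OF mG measurable_comp[OF mz mL]])
  finally have pair: "std_normal_distribution \<Otimes>\<^sub>M chi_law m = distr M (borel \<Otimes>\<^sub>M borel) (?G \<circ> (?L \<circ> ?z))" .
  have "mixed_limit_law \<nu> (sqrt (real n) * \<eta>) (chi_law m) = distr M borel (?h \<circ> (?G \<circ> (?L \<circ> ?z)))"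
    unfolding mixed_limit_law_def pair
    by (rule distr_distr[OF mh measurable_comp[OF measurable_comp[OF mz mL] mG]])
  also have "\<dots> = distr M borel (\<lambda>\<omega>. 1 / \<sigma> * (sqrt (real n) / xi X i) * (theta_AS X i \<eta> (Y \<omega>) - vec_index \<theta> i))"
    by (rule distr_cong) (simp_all only: comp_apply pointwise)
  finally show ?thesis unfolding \<nu> m_def by simp
qed

section \<open>The limit of the estimation error\<close>

theorem theorem35:
  fixes M :: "nat \<Rightarrow> 'a measure"
    and k :: "nat \<Rightarrow> nat"
    and X :: "nat \<Rightarrow> real mat"
    and \<theta> :: "nat \<Rightarrow> real Matrix.vec"
    and \<sigma> :: "nat \<Rightarrow> real"
    and u Y :: "nat \<Rightarrow> 'a \<Rightarrow> real Matrix.vec"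
    and \<eta> :: "nat \<Rightarrow> nat \<Rightarrow> real"
    and i :: nat and e :: real and \<nu> :: ereal
    and H :: "nat \<Rightarrow> real measure"
  assumes model: "\<And>n. 2 \<le> n \<Longrightarrow> gaussian_regression (M n) n (k n) (X n) (\<theta> n) (\<sigma> n) (u n) (Y n)"
    and eta_pos: "\<And>n j. 2 \<le> n \<Longrightarrow> j < k n \<Longrightarrow> 0 < \<eta> j n"
    and xi_bounded: "\<And>j. eventually (\<lambda>n. j < k n) sequentially \<Longrightarrow>
          bdd_above ((\<lambda>n. (xi (X n) j)\<^sup>2 / real n) ` {n. 2 \<le> n \<and> j < k n})"
    and i_less_k: "eventually (\<lambda>n. i < k n) sequentially"
    and xi_eta: "(\<lambda>n. xi (X n) i * \<eta> i n) \<longlonglongrightarrow> 0"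
    and e_lim: "(\<lambda>n. sqrt (real n) * \<eta> i n) \<longlonglongrightarrow> e" and e_nonneg: "0 \<le> e"
    and \<nu>_lim: "(\<lambda>n. ereal (sqrt (real n) * vec_index (\<theta> n) i / (\<sigma> n * xi (X n) i))) \<longlonglongrightarrow> \<nu>"
    and H_def: "\<And>n. H n = distr (M n) borel
          (\<lambda>\<omega>. 1 / \<sigma> n * (sqrt (real n) / xi (X n) i) *
               (theta_AS (X n) i (\<eta> i n) (Y n \<omega>) - vec_index (\<theta> n) i))"
  shows
    "(\<forall>m. eventually (\<lambda>n. n - k n = m) sequentially \<longrightarrow>
        (\<forall>v. \<nu> = ereal v \<longrightarrow>
          (\<exists>\<mu>. real_distribution \<mu> \<and>
               cdf \<mu> = limit_cdf_fixed_df m e v \<and>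
               is_atom_plus_density \<mu> (limit_atom_fixed_df m e v) (- v) (limit_dens_fixed_df m e v) \<and>
               weak_conv_m H \<mu> \<and>
               (e = 0 \<longrightarrow> \<mu> = std_normal_distribution))) \<and>
        (\<bar>\<nu>\<bar> = \<infinity> \<longrightarrow> weak_conv_m H std_normal_distribution))
   \<and> (filterlim (\<lambda>n. n - k n) at_top sequentially \<longrightarrow>
        (\<forall>v. \<nu> = ereal v \<longrightarrow>
          (\<exists>\<mu>. real_distribution \<mu> \<and>
               cdf \<mu> = limit_cdf_infinite_df e v \<and>
               is_atom_plus_density \<mu> (limit_atom_infinite_df e v) (- v) (limit_dens_infinite_df e v) \<and>
               weak_conv_m H \<mu> \<and>
               (e = 0 \<longrightarrow> \<mu> = std_normal_distribution))) \<and>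
        (\<bar>\<nu>\<bar> = \<infinity> \<longrightarrow> weak_conv_m H std_normal_distribution))"
proof -
  define t where "t n = sqrt (real n) * vec_index (\<theta> n) i / (\<sigma> n * xi (X n) i)" for n
  define d where "d n = sqrt (real n) * \<eta> i n" for n
  define K where "K n = chi_law (n - k n)" for n
  \<comment> \<open>The model is assumed from \<open>n = 2\<close> on, and the component exists from some \<open>n\<close> on.\<close>
  have H_eq: "eventually (\<lambda>n. H n = mixed_limit_law (t n) (d n) (K n)) sequentially"
    using i_less_k eventually_ge_at_top[of 2]
  proof eventually_elim
    case (elim n)
    interpret gaussian_regression "M n" n "k n" "X n" "\<theta> n" "\<sigma> n" "u n" "Y n"
      using elim by (intro model)
    show ?case unfolding H_def t_def d_def K_def using elim by (intro distr_scaled_estimation_error)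
  qed
  have t_lim: "(\<lambda>n. ereal (t n)) \<longlonglongrightarrow> \<nu>" using \<nu>_lim by (simp add: t_def)
  have d_lim: "d \<longlonglongrightarrow> e" unfolding d_def[abs_def] by (rule e_lim)
  have limit: "(\<forall>v. \<nu> = ereal v \<longrightarrow> weak_conv_m H (mixed_limit_law v e L)) \<and>
      (\<bar>\<nu>\<bar> = \<infinity> \<longrightarrow> weak_conv_m H std_normal_distribution)"
    if "real_distribution L" "weak_conv_m K L" for L
  proof -
    have K: "real_distribution (K n)" for n unfolding K_def by (rule real_distribution_chi_law)
    show ?thesis
      unfolding weak_conv_m_cong_eventually[OF H_eq]
      using weak_conv_mixed_limit_law[OF K that d_lim t_lim] by blast
  qed
  have fixed_df: "(\<forall>v. \<nu> = ereal v \<longrightarrow>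
          (\<exists>\<mu>. real_distribution \<mu> \<and>
               cdf \<mu> = limit_cdf_fixed_df m e v \<and>
               is_atom_plus_density \<mu> (limit_atom_fixed_df m e v) (- v) (limit_dens_fixed_df m e v) \<and>
               weak_conv_m H \<mu> \<and>
               (e = 0 \<longrightarrow> \<mu> = std_normal_distribution))) \<and>
        (\<bar>\<nu>\<bar> = \<infinity> \<longrightarrow> weak_conv_m H std_normal_distribution)"
    if m: "eventually (\<lambda>n. n - k n = m) sequentially" for m
  proof -
    have "eventually (\<lambda>n. 0 < m) sequentially"
      using m eventually_ge_at_top[of 2]
    proof eventually_elim
      case (elim n)
      then show ?case using gaussian_regression.k_less_n[OF model, of n] by simp
    qed
    then have m0: "0 < m" by simp
    have "eventually (\<lambda>n. K n = chi_law m) sequentially"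
      using m by eventually_elim (simp add: K_def)
    then have "weak_conv_m K (chi_law m)"
      by (subst weak_conv_m_cong_eventually) (auto simp: weak_conv_m_def weak_conv_def)
    note lim = limit[OF real_distribution_chi_law this]
    show ?thesis
    proof (intro conjI allI impI)
      fix v assume v: "\<nu> = ereal v"
      show "\<exists>\<mu>. real_distribution \<mu> \<and>
               cdf \<mu> = limit_cdf_fixed_df m e v \<and>
               is_atom_plus_density \<mu> (limit_atom_fixed_df m e v) (- v) (limit_dens_fixed_df m e v) \<and>
               weak_conv_m H \<mu> \<and>
               (e = 0 \<longrightarrow> \<mu> = std_normal_distribution)"
      proof (intro exI conjI impI)
        show "real_distribution (mixed_limit_law v e (chi_law m))"
          by (rule real_distribution_mixed_limit_law[OF real_distribution_chi_law])
        show "cdf (mixed_limit_law v e (chi_law m)) = limit_cdf_fixed_df m e v"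
          by (rule ext) (rule cdf_mixed_limit_law_chi[OF m0 e_nonneg])
        show "is_atom_plus_density (mixed_limit_law v e (chi_law m)) (limit_atom_fixed_df m e v) (- v) (limit_dens_fixed_df m e v)"
          by (rule is_atom_plus_density_mixed_limit_law_chi[OF m0 e_nonneg])
        show "weak_conv_m H (mixed_limit_law v e (chi_law m))"
          by (rule conjunct1[OF lim, rule_format, OF v])
        show "mixed_limit_law v e (chi_law m) = std_normal_distribution" if "e = 0"
          unfolding that by (rule mixed_limit_law_0[OF real_distribution_chi_law])
      qed
    next
      assume "\<bar>\<nu>\<bar> = \<infinity>"
      then show "weak_conv_m H std_normal_distribution" by (rule conjunct2[OF lim, rule_format])
    qed
  qed
  have infinite_df: "(\<forall>v. \<nu> = ereal v \<longrightarrow>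
          (\<exists>\<mu>. real_distribution \<mu> \<and>
               cdf \<mu> = limit_cdf_infinite_df e v \<and>
               is_atom_plus_density \<mu> (limit_atom_infinite_df e v) (- v) (limit_dens_infinite_df e v) \<and>
               weak_conv_m H \<mu> \<and>
               (e = 0 \<longrightarrow> \<mu> = std_normal_distribution))) \<and>
        (\<bar>\<nu>\<bar> = \<infinity> \<longrightarrow> weak_conv_m H std_normal_distribution)"
    if m: "filterlim (\<lambda>n. n - k n) at_top sequentially"
  proof -
    have return: "real_distribution (return borel (1::real))"
      by (intro real_distribution.intro prob_space_return real_distribution_axioms.intro) auto
    have "weak_conv_m K (return borel 1)"
      unfolding K_def[abs_def] by (rule weak_conv_chi_law[OF m])
    note lim = limit[OF return this, unfolded mixed_limit_law_return]
    show ?thesis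
    proof (intro conjI allI impI)
      fix v assume v: "\<nu> = ereal v"
      show "\<exists>\<mu>. real_distribution \<mu> \<and>
               cdf \<mu> = limit_cdf_infinite_df e v \<and>
               is_atom_plus_density \<mu> (limit_atom_infinite_df e v) (- v) (limit_dens_infinite_df e v) \<and>
               weak_conv_m H \<mu> \<and>
               (e = 0 \<longrightarrow> \<mu> = std_normal_distribution)"
      proof (intro exI conjI impI)
        show "real_distribution (limit_law v e)" by (rule real_distribution_limit_law)
        show "cdf (limit_law v e) = limit_cdf_infinite_df e v"
          by (rule ext) (rule cdf_limit_law[OF e_nonneg])
        show "is_atom_plus_density (limit_law v e) (limit_atom_infinite_df e v) (- v) (limit_dens_infinite_df e v)"
          by (rule is_atom_plus_density_limit_law[OF e_nonneg])
        show "weak_conv_m H (limit_law v e)"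
          by (rule conjunct1[OF lim, rule_format, OF v])
        show "limit_law v e = std_normal_distribution" if "e = 0"
          unfolding that by (rule limit_law_0)
      qed
    next
      assume "\<bar>\<nu>\<bar> = \<infinity>"
      then show "weak_conv_m H std_normal_distribution" by (rule conjunct2[OF lim, rule_format])
    qed
  qed
  show ?thesis using fixed_df infinite_df by blast
qed

end
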